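(* Assume the Axiom of Choice. Let $A$ be a $\boldsymbol{\mathit{ba}\ell}$-algebra, $X$ the set of proper archimedean $\ell$-ideals with the Alexandroff topology, $Y_A\subseteq X$ the set of maximal $\ell$-ideals, $\varphi:D(\mathbb R[B])\to N(X)$ the isomorphism with $\varphi(x_I)=\chi_{U_I}$, $\psi:N(X)\to B(Y_A)$ the restriction isomorphism, and $\gamma=\varphi\circ\alpha:A\to N(X)$. Then $D(\mathbb R[B])$, $N(X)$ and $B(Y_A)$ are isomorphic; $\psi\circ\varphi$ sends $x_I$ to the characteristic function of $\{M\in Y_A\mid I\not\subseteq M\}$ for each $I\in{\sf Arch}(A)$; $\psi\circ\gamma=\zeta_A$; and for all $a\in A$ and $I\in X$, $$\gamma(a)(I)=\sup\{r\in\mathbb R\mid (a-r)^-\in I\}.$$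
   Context: A $\boldsymbol{\mathit{ba}\ell}$-algebra is a commutative unital lattice-ordered algebra $A$ over $\mathbb R$ that is bounded (for every $a\in A$ there is an integer $n\ge1$ with $a\le n\cdot1$) and archimedean (if $na\le b$ for all $n\ge1$ then $a\le0$); reals $r$ are identified with $r\cdot1$. $a^-=(-a)\vee0$. An $\ell$-ideal is a ring ideal $I$ with $|a|\le|b|$, $b\in I\Rightarrow a\in I$; it is archimedean if $A/I$ is archimedean. ${\sf Arch}(A)$ is the frame of archimedean $\ell$-ideals ordered by inclusion, with join $I\vee J$ the least archimedean $\ell$-ideal containing $I\cup J$; $U_I=\{J\in X\mid J\vee I=A\}$. $B$ is the free boolean extension of ${\sf Arch}(A)$, ${\sf Arch}(A)\subseteq B$, $\lnot$ its complement. $\mathbb R[B]$ is the quotient of $\mathbb R[x_e\mid e\in B]$ by the ideal generated by $x_{e\wedge f}-x_ex_f$, $x_{e\vee f}-(x_e+x_f-x_ex_f)$, $x_{\lnot e}-(1-x_e)$, $x_0$; $D(\mathbb R[B])$ its Dedekind completion. $\alpha:A\to D(\mathbb R[B])$ is $\alpha(a)=-s+\bigvee\{rx_{\lnot I}\mid r\in\mathbb R,\ I\in{\sf Arch}(A),\ (a+s-r)^-\in I\}$ for any $s$ with $a+s\ge0$. For a space $X$, $B(X)$ is bounded real functions, $f_*(x)=\sup\{\inf f[U]\mid U\text{ open}\ni x\}$, $f^*(x)=\inf\{\sup f[U]\mid U\text{ open}\ni x\}$, $N(X)=\{f\mid f=(f^* )_*\}$ with operations the normalizations of pointwise ones. The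 Alexandroff topology has upsets as opens. $\zeta_A:A\to B(Y_A)$ is $\zeta_A(a)(M)=$ the unique $r\in\mathbb R$ with $a+M=r+M$. *)

theory Defs
  imports "HOL-Analysis.Analysis" "HOL-Library.Poly_Mapping"
begin

class bal_algebra = comm_ring_1 + real_algebra_1 + lattice +
  assumes bal_add_left_mono: "a \<le> b \<Longrightarrow> c + a \<le> c + b"
    and bal_mult_nonneg: "0 \<le> a \<Longrightarrow> 0 \<le> b \<Longrightarrow> 0 \<le> a * b"
    and bal_scaleR_nonneg: "0 \<le> r \<Longrightarrow> 0 \<le> a \<Longrightarrow> 0 \<le> r *\<^sub>R a"
    and bal_bounded: "\<exists>n::nat. n \<ge> 1 \<and> a \<le> of_nat n"
    and bal_archimedean: "(\<And>n::nat. n \<ge> 1 \<Longrightarrow> of_nat n * a \<le> b) \<Longrightarrow> a \<le> 0"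

definition negpart :: "'a::bal_algebra \<Rightarrow> 'a" where
  "negpart a = sup (- a) 0"

definition labs :: "'a::bal_algebra \<Rightarrow> 'a" where
  "labs a = sup a (- a)"

definition ring_ideal :: "'a::comm_ring_1 set \<Rightarrow> bool" where
  "ring_ideal I \<longleftrightarrow> 0 \<in> I \<and> (\<forall>a\<in>I. \<forall>b\<in>I. a + b \<in> I) \<and> (\<forall>a\<in>I. \<forall>c. c * a \<in> I)"

definition l_ideal :: "'a::bal_algebra set \<Rightarrow> bool" where
  "l_ideal I \<longleftrightarrow> ring_ideal I \<and> (\<forall>a b. labs a \<le> labs b \<and> b \<in> I \<longrightarrow> a \<in> I)"

text \<open>The order of the quotient A/I: a+I \<le> b+I.\<close>
definition quot_le :: "'a::bal_algebra set \<Rightarrow> 'a \<Rightarrow> 'a \<Rightarrow> bool" where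
  "quot_le I a b \<longleftrightarrow> (\<exists>c\<in>I. a \<le> b + c)"

text \<open>I is archimedean iff A/I is archimedean.\<close>
definition arch_ideal :: "'a::bal_algebra set \<Rightarrow> bool" where
  "arch_ideal I \<longleftrightarrow> l_ideal I \<and>
     (\<forall>a b. (\<forall>n::nat. n \<ge> 1 \<longrightarrow> quot_le I (of_nat n * a) b) \<longrightarrow> quot_le I a 0)"

definition Arch :: "'a::bal_algebra set set" where
  "Arch = {I. arch_ideal I}"

definition arch_join :: "'a::bal_algebra set \<Rightarrow> 'a set \<Rightarrow> 'a set" where
  "arch_join I J = \<Inter>{K \<in> Arch. I \<union> J \<subseteq> K}"

definition Xsp :: "'a::bal_algebra set set" where
  "Xsp = {I \<in> Arch. I \<noteq> UNIV}"

definition Uset :: "'a::bal_algebra set \<Rightarrow> 'a set set" where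
  "Uset I = {J \<in> Xsp. arch_join J I = UNIV}"

definition Ysp :: "'a::bal_algebra set set" where
  "Ysp = {M. l_ideal M \<and> M \<noteq> UNIV \<and> (\<forall>J. l_ideal J \<and> M \<subseteq> J \<longrightarrow> J = M \<or> J = UNIV)}"

definition bool_generated :: "'b::boolean_algebra set \<Rightarrow> 'b set" where
  "bool_generated S = \<Inter>{C. S \<subseteq> C \<and> bot \<in> C \<and> top \<in> C \<and>
      (\<forall>x\<in>C. \<forall>y\<in>C. sup x y \<in> C \<and> inf x y \<in> C) \<and> (\<forall>x\<in>C. - x \<in> C)}"

definition free_bool_ext :: "('a::bal_algebra set \<Rightarrow> 'b::boolean_algebra) \<Rightarrow> bool" where
  "free_bool_ext e \<longleftrightarrow> inj_on e Arch \<and>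
     (\<forall>I\<in>Arch. \<forall>J\<in>Arch. e (I \<inter> J) = inf (e I) (e J) \<and> e (arch_join I J) = sup (e I) (e J)) \<and>
     e {0} = bot \<and> e UNIV = top \<and> bool_generated (e ` Arch) = UNIV"

type_synonym 'b rpoly = "('b \<Rightarrow>\<^sub>0 nat) \<Rightarrow>\<^sub>0 real"

definition pvar :: "'b \<Rightarrow> 'b rpoly" where
  "pvar e = Poly_Mapping.single (Poly_Mapping.single e 1) 1"

definition pconst :: "real \<Rightarrow> 'b rpoly" where
  "pconst c = Poly_Mapping.single 0 c"

definition peval :: "('b \<Rightarrow> 'd::{real_algebra_1,comm_ring_1}) \<Rightarrow> 'b rpoly \<Rightarrow> 'd" where
  "peval x p = (\<Sum>mo\<in>Poly_Mapping.keys p. Poly_Mapping.lookup p mo *\<^sub>R (\<Prod>v\<in>Poly_Mapping.keys mo. x v ^ Poly_Mapping.lookup mo v))"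

definition ideal_gen :: "'r::comm_ring_1 set \<Rightarrow> 'r set" where
  "ideal_gen G = \<Inter>{J. G \<subseteq> J \<and> ring_ideal J}"

definition RB_rels :: "'b::boolean_algebra rpoly set" where
  "RB_rels = {pvar (inf e f) - pvar e * pvar f | e f. True}
     \<union> {pvar (sup e f) - (pvar e + pvar f - pvar e * pvar f) | e f. True}
     \<union> {pvar (- e) - (1 - pvar e) | e. True}
     \<union> {pvar bot}"

definition is_lub :: "'d::order set \<Rightarrow> 'd \<Rightarrow> bool" where
  "is_lub S s \<longleftrightarrow> (\<forall>x\<in>S. x \<le> s) \<and> (\<forall>u. (\<forall>x\<in>S. x \<le> u) \<longrightarrow> s \<le> u)"

definition is_glb :: "'d::order set \<Rightarrow> 'd \<Rightarrow> bool" where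
  "is_glb S s \<longleftrightarrow> (\<forall>x\<in>S. s \<le> x) \<and> (\<forall>u. (\<forall>x\<in>S. u \<le> x) \<longrightarrow> u \<le> s)"

definition dlub :: "'d::order set \<Rightarrow> 'd" where
  "dlub S = (THE s. is_lub S s)"

definition dedekind_complete :: "'d::order itself \<Rightarrow> bool" where
  "dedekind_complete _ \<longleftrightarrow>
     (\<forall>S::'d set. S \<noteq> {} \<and> (\<exists>u. \<forall>x\<in>S. x \<le> u) \<longrightarrow> (\<exists>s. is_lub S s))"

text \<open>The ba-ell-algebra 'd, together with x : B \<rightarrow> 'd, is the Dedekind completion
  of R[B]: the evaluation R[x_e | e in B] \<rightarrow> 'd has kernel exactly the ideal
  generated by the defining relations (so its image is a copy of R[B]), 'd is
  Dedekind complete, and the copy of R[B] is join- and meet-dense in 'd.\<close>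
definition dedekind_completion_RB :: "('b::boolean_algebra \<Rightarrow> 'd::bal_algebra) \<Rightarrow> bool" where
  "dedekind_completion_RB x \<longleftrightarrow>
     {p. peval x p = 0} = ideal_gen RB_rels \<and>
     dedekind_complete TYPE('d) \<and>
     (\<forall>d. is_lub {y \<in> range (peval x). y \<le> d} d \<and> is_glb {y \<in> range (peval x). d \<le> y} d)"

definition alpha :: "('a::bal_algebra set \<Rightarrow> 'b::boolean_algebra) \<Rightarrow> ('b \<Rightarrow> 'd::bal_algebra) \<Rightarrow> 'a \<Rightarrow> 'd" where
  "alpha e x a = (let s = (SOME s::real. 0 \<le> a + of_real s) in
     - of_real s + dlub {r *\<^sub>R x (- e I) | r I. I \<in> Arch \<and> negpart (a + of_real s - of_real r) \<in> I})"

definition Xopen :: "'a::bal_algebra set set \<Rightarrow> bool" where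
  "Xopen U \<longleftrightarrow> U \<subseteq> Xsp \<and> (\<forall>I\<in>U. \<forall>J\<in>Xsp. I \<subseteq> J \<longrightarrow> J \<in> U)"

definition lower_env :: "('a::bal_algebra set \<Rightarrow> real) \<Rightarrow> 'a set \<Rightarrow> real" where
  "lower_env f I = (if I \<in> Xsp then Sup {Inf (f ` U) | U. Xopen U \<and> I \<in> U} else 0)"

definition upper_env :: "('a::bal_algebra set \<Rightarrow> real) \<Rightarrow> 'a set \<Rightarrow> real" where
  "upper_env f I = (if I \<in> Xsp then Inf {Sup (f ` U) | U. Xopen U \<and> I \<in> U} else 0)"

definition nrm :: "('a::bal_algebra set \<Rightarrow> real) \<Rightarrow> 'a set \<Rightarrow> real" where
  "nrm f = lower_env (upper_env f)"

definition BX :: "('a::bal_algebra set \<Rightarrow> real) set" where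
  "BX = {f. bounded (f ` Xsp) \<and> (\<forall>I. I \<notin> Xsp \<longrightarrow> f I = 0)}"

definition NX :: "('a::bal_algebra set \<Rightarrow> real) set" where
  "NX = {f \<in> BX. f = nrm f}"

definition chiX :: "'a::bal_algebra set set \<Rightarrow> 'a set \<Rightarrow> real" where
  "chiX U I = (if I \<in> Xsp \<and> I \<in> U then 1 else 0)"

definition iso_DN :: "('d::bal_algebra \<Rightarrow> 'a::bal_algebra set \<Rightarrow> real) \<Rightarrow> bool" where
  "iso_DN \<phi> \<longleftrightarrow> bij_betw \<phi> UNIV NX \<and>
     (\<forall>a b. \<phi> (a + b) = nrm (\<lambda>I. \<phi> a I + \<phi> b I)) \<and>
     (\<forall>a b. \<phi> (a * b) = nrm (\<lambda>I. \<phi> a I * \<phi> b I)) \<and>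
     (\<forall>r a. \<phi> (r *\<^sub>R a) = nrm (\<lambda>I. r * \<phi> a I)) \<and>
     (\<forall>a b. \<phi> (sup a b) = nrm (\<lambda>I. max (\<phi> a I) (\<phi> b I))) \<and>
     (\<forall>a b. \<phi> (inf a b) = nrm (\<lambda>I. min (\<phi> a I) (\<phi> b I))) \<and>
     \<phi> 1 = nrm (chiX Xsp)"

definition BY :: "('a::bal_algebra set \<Rightarrow> real) set" where
  "BY = {f. bounded (f ` Ysp) \<and> (\<forall>M. M \<notin> Ysp \<longrightarrow> f M = 0)}"

definition psi :: "('a::bal_algebra set \<Rightarrow> real) \<Rightarrow> 'a set \<Rightarrow> real" where
  "psi f M = (if M \<in> Ysp then f M else 0)"

definition chiY :: "'a::bal_algebra set set \<Rightarrow> 'a set \<Rightarrow> real" where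
  "chiY U M = (if M \<in> Ysp \<and> M \<in> U then 1 else 0)"

definition iso_NY :: "(('a::bal_algebra set \<Rightarrow> real) \<Rightarrow> ('a set \<Rightarrow> real)) \<Rightarrow> bool" where
  "iso_NY pp \<longleftrightarrow> bij_betw pp NX BY \<and>
     (\<forall>f\<in>NX. \<forall>g\<in>NX.
        pp (nrm (\<lambda>I. f I + g I)) = (\<lambda>M. pp f M + pp g M) \<and>
        pp (nrm (\<lambda>I. f I * g I)) = (\<lambda>M. pp f M * pp g M) \<and>
        pp (nrm (\<lambda>I. max (f I) (g I))) = (\<lambda>M. max (pp f M) (pp g M)) \<and>
        pp (nrm (\<lambda>I. min (f I) (g I))) = (\<lambda>M. min (pp f M) (pp g M))) \<and>
     (\<forall>f\<in>NX. \<forall>r. pp (nrm (\<lambda>I. r * f I)) = (\<lambda>M. r * pp f M)) \<and>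
     pp (nrm (chiX Xsp)) = chiY Ysp"

definition zeta :: "'a::bal_algebra \<Rightarrow> 'a set \<Rightarrow> real" where
  "zeta a M = (if M \<in> Ysp then (THE r. a - of_real r \<in> M) else 0)"

end

theory Submission
  imports Defs "HOL-Library.Lattice_Algebras"
begin

text \<open>
  Every archimedean \<open>\<ell>\<close>-ideal is an intersection of maximal ones, and \<open>A/M\<close> is the real line for
  maximal \<open>M\<close>. Hence the normalization of \<open>f\<close> on the Alexandroff space \<open>X\<close> is
  \<open>I \<mapsto> inf {f M | I \<subseteq> M \<in> Y}\<close>, a normal function is determined by its arbitrary bounded restriction
  to \<open>Y\<close>, and \<open>N(X)\<close> is \<open>B(Y)\<close>. In the free boolean extension \<open>B\<close> the complements \<open>\<not>M\<close> with \<open>M \<in> Y\<close> are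
  exactly the atoms, and every nonzero element lies above one of them. So each \<open>d\<close> in the
  Dedekind completion has a real coordinate at \<open>M\<close>, the \<open>r\<close> with \<open>d x = r x\<close> for the idempotent \<open>x\<close> of
  the atom \<open>\<not>M\<close>; density of \<open>\<real>[B]\<close> makes the coordinates an isomorphism onto \<open>B(Y)\<close>, and the
  coordinates of \<open>\<alpha>(a)\<close> are the residues of \<open>a\<close> modulo the maximal \<open>\<ell>\<close>-ideals.
\<close>

subsection \<open>Bounded archimedean \<open>\<ell>\<close>-algebras\<close>

context bal_algebra
begin

subclass ordered_ring
proof
  fix a b c :: 'a
  show "a \<le> b \<Longrightarrow> c + a \<le> c + b" by (rule bal_add_left_mono)
  assume ab: "a \<le> b" and c: "0 \<le> c"
  have "0 \<le> b - a" using bal_add_left_mono[OF ab, of "- a"] by simp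
  then have "0 \<le> c * (b - a)" "0 \<le> (b - a) * c" using c bal_mult_nonneg by auto
  then show "c * a \<le> c * b" "a * c \<le> b * c"
    using bal_add_left_mono[of 0 "c * (b - a)" "c * a"]
      bal_add_left_mono[of 0 "(b - a) * c" "a * c"] by (simp_all add: algebra_simps)
qed

subclass ordered_real_vector
proof
  fix a b :: 'a and r s :: real
  show "r *\<^sub>R a \<le> r *\<^sub>R b" if "a \<le> b" "0 \<le> r"
    using bal_scaleR_nonneg[of r "b - a"] bal_add_left_mono[of 0 "r *\<^sub>R (b - a)" "r *\<^sub>R a"]
      that scaleR_add_right[of r "b - a" a] by (simp add: add.commute[of "r *\<^sub>R (b - a)"])
  show "r *\<^sub>R a \<le> s *\<^sub>R a" if "r \<le> s" "0 \<le> a"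
    using bal_scaleR_nonneg[of "s - r" a] bal_add_left_mono[of 0 "(s - r) *\<^sub>R a" "r *\<^sub>R a"]
      that scaleR_add_left[of r "s - r" a] by simp
qed

subclass lattice_ab_group_add ..

end

text \<open>Boundedness applied to the element 0 gives \<open>0 <= of_nat n\<close> with
  \<open>n >= 1\<close>; scaling by \<open>1 / n\<close> leaves 1.\<close>

lemma one_nonneg: "(0::'a::bal_algebra) \<le> 1"
proof -
  obtain n :: nat where n: "n \<ge> 1" "(0::'a) \<le> of_nat n" using bal_bounded by blast
  have "0 \<le> (1 / real n) *\<^sub>R (of_nat n :: 'a)"
    by (rule bal_scaleR_nonneg) (use n in auto)
  also have "(1 / real n) *\<^sub>R (of_nat n :: 'a) = (1 / real n) *\<^sub>R of_real (real n)" by simp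
  also have "\<dots> = 1" using n by (simp add: scaleR_conv_of_real flip: of_real_mult del: of_real_of_nat_eq)
  finally show ?thesis .
qed

lemma of_real_mono: "r \<le> s \<Longrightarrow> (of_real r :: 'a::bal_algebra) \<le> of_real s"
  unfolding of_real_def by (rule scaleR_right_mono[OF _ one_nonneg])

lemma of_real_nonneg: "0 \<le> r \<Longrightarrow> (0 :: 'a::bal_algebra) \<le> of_real r"
  using of_real_mono[of 0 r] by simp

lemma scaleR_le_cancel:
  "0 < r \<Longrightarrow> r *\<^sub>R a \<le> r *\<^sub>R b \<Longrightarrow> a \<le> (b::'a::bal_algebra)"
  using scaleR_left_mono[of "r *\<^sub>R a" "r *\<^sub>R b" "1 / r"] by simp

lemma ex_real_bound:
  fixes a :: "'a::bal_algebra"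
  obtains r :: real where "1 \<le> r" "a \<le> of_real r" "- of_real r \<le> a"
proof -
  obtain m :: nat where m: "m \<ge> 1" "a \<le> of_nat m" using bal_bounded by blast
  obtain n :: nat where n: "n \<ge> 1" "- a \<le> of_nat n" using bal_bounded by blast
  define r where "r = max (real m) (real n)"
  have "of_real (real m) \<le> (of_real r :: 'a)" "of_real (real n) \<le> (of_real r :: 'a)"
    by (rule of_real_mono, simp add: r_def)+
  then have "a \<le> of_real r" "- a \<le> of_real r" using m n by auto
  moreover have "1 \<le> r" using m by (simp add: r_def)
  ultimately show thesis using that minus_le_iff by blast
qed

text \<open>This is the f-ring property. Boundedness replaces the factor \<open>c\<close> by a real
  \<open>n\<close>, and a common lower bound of \<open>c * a\<close> and \<open>b\<close>, scaled by
  \<open>1 / n\<close>, lies below \<open>inf a b\<close>.\<close>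

lemma inf_mult_eq_0:
  fixes a b c :: "'a::bal_algebra"
  assumes ab: "inf a b = 0" and c: "0 \<le> c"
  shows "inf (c * a) b = 0"
proof -
  have a0: "0 \<le> a" and b0: "0 \<le> b" using ab by (metis inf_le1, metis inf_le2)
  obtain n where n: "1 \<le> n" "c \<le> of_real n" using ex_real_bound[of c] by metis
  have ca: "c * a \<le> n *\<^sub>R a" using mult_right_mono[OF n(2) a0] by (simp add: scaleR_conv_of_real)
  have nb: "b \<le> n *\<^sub>R b" using scaleR_right_mono[OF n(1) b0] by simp
  have "(1 / n) *\<^sub>R z \<le> inf a b" if "z \<le> c * a" "z \<le> b" for z
  proof (rule inf_greatest)
    have "z \<le> n *\<^sub>R a" "z \<le> n *\<^sub>R b" using that ca nb by auto
    then show "(1 / n) *\<^sub>R z \<le> a" "(1 / n) *\<^sub>R z \<le> b"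
      using n(1) scaleR_left_mono[of z _ "1 / n"] by fastforce+
  qed
  then have "(1 / n) *\<^sub>R inf (c * a) b \<le> (1 / n) *\<^sub>R 0" using ab by simp
  then have "inf (c * a) b \<le> 0" by (rule scaleR_le_cancel[rotated]) (use n in simp)
  moreover have "0 \<le> inf (c * a) b" using a0 b0 c by (simp add: bal_mult_nonneg)
  ultimately show ?thesis by (rule antisym)
qed

lemma pos_part_decomp: "(a::'a::bal_algebra) = sup a 0 - sup (- a) 0"
proof -
  have "sup a 0 - a = sup 0 (- a)" using add_sup_distrib_right[of a 0 "- a"] by simp
  then show ?thesis by (simp only: sup_commute[of "- a"]) (metis add_diff_cancel_left' diff_add_cancel)
qed

lemma pos_part_inf_neg_part: "inf (sup a 0) (sup (- a) 0) = (0::'a::bal_algebra)"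
proof -
  have "sup a 0 = a + sup (- a) 0" using pos_part_decomp[of a] by (metis diff_add_cancel)
  then have "inf (sup a 0) (sup (- a) 0) = inf a 0 + sup (- a) 0"
    using add_inf_distrib_right[of a 0 "sup (- a) 0"] by simp
  also have "\<dots> = 0" using inf_eq_neg_sup[of a 0] by (metis left_minus minus_zero)
  finally show ?thesis .
qed

text \<open>Two applications of \<open>inf_mult_eq_0\<close>, one for each factor, make the product
  disjoint from itself, hence zero.\<close>

lemma pos_part_mult_neg_part: "sup a 0 * sup (- a) 0 = (0::'a::bal_algebra)"
proof -
  have "inf (sup (- a) 0 * sup a 0) (sup (- a) 0) = 0"
    by (intro inf_mult_eq_0 pos_part_inf_neg_part) simp
  then have "inf (sup a 0 * sup (- a) 0) (sup (- a) 0 * sup a 0) = 0"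
    by (intro inf_mult_eq_0) (simp_all add: inf_commute)
  then show ?thesis by (simp add: mult.commute)
qed

text \<open>The mixed terms vanish, so the square is the sum of the squares of the two parts. It
  will make the idempotents of the completion nonnegative.\<close>

lemma square_nonneg: "0 \<le> a * (a::'a::bal_algebra)"
proof -
  obtain p n where pn: "a = p - n" "p * n = 0" "0 \<le> p" "0 \<le> n"
    using pos_part_decomp[of a] pos_part_mult_neg_part[of a] sup_ge2 by blast
  have "a * a = p * p + n * n" using pn(2) by (simp add: pn(1) algebra_simps)
  then show ?thesis using pn by (simp add: bal_mult_nonneg)
qed

lemma labs_nonneg: "0 \<le> labs (a::'a::bal_algebra)"
proof -
  have "a + - a \<le> labs a + labs a" unfolding labs_def by (intro add_mono) auto
  then have "2 *\<^sub>R 0 \<le> 2 *\<^sub>R labs a" by (simp add: scaleR_2)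
  then show ?thesis by (rule scaleR_le_cancel[rotated]) simp
qed

lemma labs_of_nonneg: "0 \<le> a \<Longrightarrow> labs a = (a::'a::bal_algebra)"
  unfolding labs_def by (simp add: sup_absorb1 order_trans[of "- a" 0 a])

lemma labs_le_iff: "labs a \<le> b \<longleftrightarrow> a \<le> b \<and> - a \<le> (b::'a::bal_algebra)"
  by (simp add: labs_def)

text \<open>Twice the difference of the two sides is
  \<open>(n - c) * (labs a + a) + (n + c) * (labs a - a)\<close>, a sum of products of nonnegative
  elements.\<close>

lemma mult_le_labs:
  fixes a c :: "'a::bal_algebra"
  assumes "c \<le> of_real n" "- of_real n \<le> c"
  shows "c * a \<le> n *\<^sub>R labs a"
proof -
  have "- a \<le> labs a" "a \<le> labs a" by (simp_all add: labs_def)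
  then have a: "0 \<le> labs a + a" "0 \<le> labs a - a"
    using add_right_mono[of "- a" "labs a" a] by simp_all
  have c: "0 \<le> of_real n - c" "0 \<le> of_real n + c"
    using assms add_left_mono[of "- of_real n" c "of_real n"] by simp_all
  have "0 \<le> (of_real n - c) * (labs a + a)" "0 \<le> (of_real n + c) * (labs a - a)"
    using a c by (auto intro: bal_mult_nonneg)
  then have "0 \<le> (of_real n - c) * (labs a + a) + (of_real n + c) * (labs a - a)" by simp
  also have "\<dots> = 2 *\<^sub>R (n *\<^sub>R labs a) - 2 *\<^sub>R (c * a)"
    by (simp add: scaleR_conv_of_real algebra_simps)
  finally have "2 *\<^sub>R (c * a) \<le> 2 *\<^sub>R (n *\<^sub>R labs a)" by simp
  then show ?thesis by (rule scaleR_le_cancel[rotated]) simp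
qed

lemma labs_mult_le:
  fixes a c :: "'a::bal_algebra"
  assumes "c \<le> of_real n" "- of_real n \<le> c"
  shows "labs (c * a) \<le> n *\<^sub>R labs a"
proof -
  have "- c \<le> of_real n" "- of_real n \<le> - c" using assms by (simp_all add: minus_le_iff)
  from mult_le_labs[OF this, of a] mult_le_labs[OF assms, of a]
  show ?thesis by (simp add: labs_le_iff)
qed

subsection \<open>Archimedean \<open>\<ell>\<close>-ideals as intersections of maximal ones\<close>

context
  fixes I :: "'a::bal_algebra set"
  assumes I: "l_ideal I"
begin

lemma l_ideal_0: "0 \<in> I"
  and l_ideal_add: "a \<in> I \<Longrightarrow> b \<in> I \<Longrightarrow> a + b \<in> I"
  and l_ideal_mult: "a \<in> I \<Longrightarrow> c * a \<in> I"
  and l_ideal_solid: "labs a \<le> labs b \<Longrightarrow> b \<in> I \<Longrightarrow> a \<in> I"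
  using I unfolding l_ideal_def ring_ideal_def by blast+

lemma l_ideal_minus: "a \<in> I \<Longrightarrow> - a \<in> I"
  using l_ideal_mult[of a "- 1"] by simp

lemma l_ideal_diff: "a \<in> I \<Longrightarrow> b \<in> I \<Longrightarrow> a - b \<in> I"
  using l_ideal_add[of a "- b"] l_ideal_minus by simp

lemma l_ideal_scaleR: "a \<in> I \<Longrightarrow> r *\<^sub>R a \<in> I"
  using l_ideal_mult[of a "of_real r"] by (simp add: scaleR_conv_of_real)

lemma l_ideal_labs: "labs a \<in> I \<longleftrightarrow> a \<in> I"
  using l_ideal_solid[of a "labs a"] l_ideal_solid[of "labs a" a]
  by (auto simp: labs_of_nonneg[OF labs_nonneg])

lemma l_ideal_between:
  assumes "a \<le> b" "- a \<le> b" "b \<in> I"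
  shows "a \<in> I"
proof (rule l_ideal_solid)
  have "labs a \<le> b" using assms by (simp add: labs_le_iff)
  moreover have "b \<le> labs b" by (simp add: labs_def)
  ultimately show "labs a \<le> labs b" by (rule order_trans)
qed fact

lemma l_ideal_convex: "0 \<le> a \<Longrightarrow> a \<le> b \<Longrightarrow> b \<in> I \<Longrightarrow> a \<in> I"
  by (rule l_ideal_between[of a b]) (auto intro: order_trans[of "- a" 0])

lemma l_ideal_pos_part: "a \<le> b \<Longrightarrow> b \<in> I \<Longrightarrow> sup a 0 \<in> I"
  using l_ideal_convex[of "sup a 0" "labs b"] labs_nonneg[of b] l_ideal_labs[of b]
    sup_ge1[of b "- b", folded labs_def] by (meson le_sup_iff order_trans sup_ge2)

lemma l_ideal_UNIV_iff: "I = UNIV \<longleftrightarrow> 1 \<in> I"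
  using l_ideal_mult[of 1] by auto

lemma l_ideal_of_real:
  assumes "0 < r" "of_real r \<le> a" "a \<in> I"
  shows "I = UNIV"
proof -
  have "(1 / r) *\<^sub>R of_real r \<in> I"
    by (intro l_ideal_scaleR l_ideal_convex[OF _ assms(2,3)]) (use assms in \<open>simp add: of_real_nonneg\<close>)
  moreover have "(1 / r) *\<^sub>R of_real r = (1::'a)"
    using assms by (simp add: of_real_def)
  ultimately show ?thesis by (simp add: l_ideal_UNIV_iff)
qed

text \<open>The existential witness in the order of the quotient becomes one fixed element, the same
  for all ideals.\<close>

lemma quot_le_iff: "quot_le I a b \<longleftrightarrow> sup (a - b) 0 \<in> I"
proof
  assume "quot_le I a b"
  then obtain c where "c \<in> I" "a \<le> b + c" by (auto simp: quot_le_def)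
  then show "sup (a - b) 0 \<in> I" using l_ideal_pos_part[of "a - b" c] by (simp add: diff_le_eq add.commute)
next
  assume "sup (a - b) 0 \<in> I"
  moreover have "a \<le> b + sup (a - b) 0" using sup_ge1[of "a - b" 0] by (simp only: diff_le_eq add.commute)
  ultimately show "quot_le I a b" unfolding quot_le_def by blast
qed

end

text \<open>For an l-ideal \<open>J\<close> and \<open>0 <= u\<close> this is the l-ideal generated
  by \<open>J\<close> and \<open>u\<close>; by boundedness, real coefficients \<open>t\<close>
  suffice in place of ring multiples of \<open>u\<close>.\<close>

definition l_ideal_insert :: "'a::bal_algebra set \<Rightarrow> 'a \<Rightarrow> 'a set" where
  "l_ideal_insert J u = {a. \<exists>j\<in>J. \<exists>t\<ge>0. labs a \<le> j + t *\<^sub>R u}"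

lemma labs_triangle: "labs (a + b) \<le> labs a + labs (b::'a::bal_algebra)"
  using add_mono[of a "labs a" b "labs b"] add_mono[of "- a" "labs a" "- b" "labs b"]
  by (simp add: labs_le_iff) (simp add: labs_def)

lemma l_ideal_l_ideal_insert:
  fixes u :: "'a::bal_algebra"
  assumes J: "l_ideal J" and u: "0 \<le> u"
  shows "l_ideal (l_ideal_insert J u)"
  unfolding l_ideal_def ring_ideal_def
proof (intro conjI ballI allI impI)
  show "0 \<in> l_ideal_insert J u" unfolding l_ideal_insert_def
    using l_ideal_0[OF J] by (auto intro!: bexI[of _ 0] exI[of _ 0] simp: labs_def)
next
  fix a b assume "a \<in> l_ideal_insert J u" "b \<in> l_ideal_insert J u"
  then obtain i j s t where *: "i \<in> J" "j \<in> J" "s \<ge> 0" "t \<ge> 0"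
    "labs a \<le> i + s *\<^sub>R u" "labs b \<le> j + t *\<^sub>R u" unfolding l_ideal_insert_def by blast
  have "labs (a + b) \<le> (i + j) + (s + t) *\<^sub>R u"
    using order_trans[OF labs_triangle add_mono[OF *(5,6)]] by (simp add: algebra_simps)
  then show "a + b \<in> l_ideal_insert J u" unfolding l_ideal_insert_def
    using * l_ideal_add[OF J] by (auto intro!: bexI[of _ "i + j"] exI[of _ "s + t"])
next
  fix a c :: 'a assume "a \<in> l_ideal_insert J u"
  then obtain j t where *: "j \<in> J" "t \<ge> 0" "labs a \<le> j + t *\<^sub>R u"
    unfolding l_ideal_insert_def by blast
  obtain n where n: "1 \<le> n" "c \<le> of_real n" "- of_real n \<le> c" using ex_real_bound by blast
  have "labs (c * a) \<le> n *\<^sub>R labs a" using n by (intro labs_mult_le)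
  also have "\<dots> \<le> n *\<^sub>R (j + t *\<^sub>R u)" using n * by (intro scaleR_left_mono) auto
  finally have "labs (c * a) \<le> n *\<^sub>R j + (n * t) *\<^sub>R u" by (simp add: algebra_simps)
  then show "c * a \<in> l_ideal_insert J u" unfolding l_ideal_insert_def
    using n * l_ideal_scaleR[OF J] by (auto intro!: bexI[of _ "n *\<^sub>R j"] exI[of _ "n * t"])
next
  fix a b assume "labs a \<le> labs b \<and> b \<in> l_ideal_insert J u"
  then show "a \<in> l_ideal_insert J u" unfolding l_ideal_insert_def using order_trans by blast
qed

lemma l_ideal_insert_superset:
  assumes J: "l_ideal J" shows "J \<subseteq> l_ideal_insert J u"
proof
  fix a assume "a \<in> J"
  then have "labs a \<in> J" using l_ideal_labs[OF J] by simp
  then show "a \<in> l_ideal_insert J u" unfolding l_ideal_insert_def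
    by (auto intro!: bexI[of _ "labs a"] exI[of _ 0])
qed

lemma l_ideal_insert_mem:
  assumes J: "l_ideal J" and u: "0 \<le> u" shows "u \<in> l_ideal_insert J u"
  unfolding l_ideal_insert_def
  using l_ideal_0[OF J] u by (auto intro!: bexI[of _ 0] exI[of _ 1] simp: labs_of_nonneg)

text \<open>A relation \<open>1 \<le> j + t u\<^sup>-\<close> turns into \<open>u\<^sup>+ \<le> j u\<^sup>+\<close> after multiplication by \<open>u\<^sup>+\<close>.\<close>
lemma l_ideal_insert_neg_part_proper:
  assumes J: "l_ideal J" and u: "sup u 0 \<notin> J"
  shows "l_ideal_insert J (sup (- u) 0) \<noteq> UNIV"
proof
  assume "l_ideal_insert J (sup (- u) 0) = UNIV"
  then obtain j t where j: "j \<in> J" and 1: "labs 1 \<le> j + t *\<^sub>R sup (- u) 0"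
    unfolding l_ideal_insert_def by blast
  have "1 \<le> j + t *\<^sub>R sup (- u) 0" using 1 by (simp add: labs_of_nonneg one_nonneg)
  from mult_left_mono[OF this, of "sup u 0"]
  have "sup u 0 \<le> sup u 0 * j"
    by (simp add: distrib_left pos_part_mult_neg_part)
  then have "sup u 0 \<in> J" by (rule l_ideal_convex[OF J sup_ge2]) (rule l_ideal_mult[OF J j])
  with u show False ..
qed

lemma ex_maximal_l_ideal:
  assumes J: "l_ideal J" and "J \<noteq> UNIV"
  shows "\<exists>M\<in>Ysp. J \<subseteq> M"
proof -
  \<comment> \<open>Properness is expressed by omitting 1, a condition that passes to unions of
    chains.\<close>
  let ?A = "{K. l_ideal K \<and> 1 \<notin> K \<and> J \<subseteq> K}"
  have "\<exists>M\<in>?A. \<forall>X\<in>?A. M \<subseteq> X \<longrightarrow> X = M"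
  proof (rule subset_Zorn_nonempty)
    show "?A \<noteq> {}" using assms l_ideal_UNIV_iff by blast
  next
    fix C assume C: "C \<noteq> {}" "subset.chain ?A C"
    have CA: "C \<subseteq> ?A" using C by (simp add: subset.chain_def)
    have ch: "K \<subseteq> L \<or> L \<subseteq> K" if "K \<in> C" "L \<in> C" for K L
      using that C(2) by (auto simp: subset_chain_def)
    have "l_ideal (\<Union>C)" unfolding l_ideal_def ring_ideal_def
    proof (intro conjI ballI allI impI)
      show "0 \<in> \<Union>C" using C(1) CA l_ideal_0 by blast
      show "a + b \<in> \<Union>C" if ab: "a \<in> \<Union>C" "b \<in> \<Union>C" for a b
      proof -
        obtain K L where KL: "a \<in> K" "b \<in> L" "K \<in> C" "L \<in> C" using ab by blast
        then have "\<exists>P\<in>C. a \<in> P \<and> b \<in> P" using ch[of K L] by blast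
        then show ?thesis using CA l_ideal_add by blast
      qed
      show "c * a \<in> \<Union>C" if "a \<in> \<Union>C" for a c
        using that CA l_ideal_mult by blast
      show "a \<in> \<Union>C" if "labs a \<le> labs b \<and> b \<in> \<Union>C" for a b
        using that CA l_ideal_solid by blast
    qed
    then show "\<Union>C \<in> ?A" using C(1) CA by blast
  qed
  then obtain M where M: "l_ideal M" "1 \<notin> M" "J \<subseteq> M"
    and max: "\<And>X. l_ideal X \<Longrightarrow> 1 \<notin> X \<Longrightarrow> M \<subseteq> X \<Longrightarrow> X = M" by auto
  have "M \<in> Ysp" unfolding Ysp_def using M max l_ideal_UNIV_iff by blast
  then show ?thesis using M by blast
qed

text \<open>Some \<open>n\<close> keeps the positive part of \<open>labs c - 1/n\<close> outside
  \<open>J\<close>, since otherwise \<open>n * labs c <= 1\<close> modulo \<open>J\<close> for all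
  \<open>n\<close>. A maximal l-ideal containing \<open>J\<close> and the corresponding negative
  part has \<open>labs c >= 1/n\<close> in its quotient, so it misses \<open>c\<close>.\<close>

lemma arch_ideal_separation:
  fixes c :: "'a::bal_algebra"
  assumes J: "arch_ideal J" and c: "c \<notin> J"
  shows "\<exists>M\<in>Ysp. J \<subseteq> M \<and> c \<notin> M"
proof -
  have Jl: "l_ideal J" using J by (simp add: arch_ideal_def)
  have c': "labs c \<notin> J" using c l_ideal_labs[OF Jl] by blast
  have "\<exists>n::nat. n \<ge> 1 \<and> sup (labs c - of_real (1 / real n)) 0 \<notin> J"
  proof (rule ccontr)
    assume neg: "\<not> ?thesis"
    have "quot_le J (of_nat n * labs c) 1" if n: "n \<ge> 1" for n :: nat
    proof -
      let ?u = "sup (labs c - of_real (1 / n)) 0"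
      have "?u \<in> J" using neg n by blast
      then have "real n *\<^sub>R ?u \<in> J" by (rule l_ideal_scaleR[OF Jl])
      have "labs c - of_real (1 / n) \<le> ?u" by simp
      then have "real n *\<^sub>R (labs c - of_real (1 / n)) \<le> real n *\<^sub>R ?u" by (intro scaleR_left_mono) auto
      moreover have "real n *\<^sub>R of_real (1 / n) = (1::'a)" using n by (simp add: of_real_def)
      ultimately have "real n *\<^sub>R labs c \<le> 1 + real n *\<^sub>R ?u"
        by (simp only: scaleR_diff_right diff_le_eq add.commute)
      then have "of_nat n * labs c \<le> 1 + real n *\<^sub>R ?u" by (simp add: scaleR_conv_of_real)
      then show ?thesis unfolding quot_le_def using \<open>real n *\<^sub>R ?u \<in> J\<close> by blast
    qed
    then have "quot_le J (labs c) 0" using J unfolding arch_ideal_def by blast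
    then have "labs c \<in> J" using quot_le_iff[OF Jl] labs_nonneg[of c] by (simp add: sup_absorb1)
    with c' show False ..
  qed
  then obtain n :: nat where n: "n \<ge> 1" and u: "sup (labs c - of_real (1 / n)) 0 \<notin> J" by blast
  let ?w = "sup (- (labs c - of_real (1 / n))) 0"
  let ?K = "l_ideal_insert J ?w"
  have "l_ideal ?K" by (rule l_ideal_l_ideal_insert[OF Jl]) simp
  then obtain M where M: "M \<in> Ysp" "?K \<subseteq> M"
    using ex_maximal_l_ideal l_ideal_insert_neg_part_proper[OF Jl u] by blast
  have Ml: "l_ideal M" "M \<noteq> UNIV" using M(1) by (auto simp: Ysp_def)
  have "?w \<in> M" using M(2) l_ideal_insert_mem[OF Jl] by auto
  have "c \<notin> M"
  proof
    assume "c \<in> M"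
    then have "labs c + ?w \<in> M" using l_ideal_labs[OF Ml(1)] l_ideal_add[OF Ml(1)] \<open>?w \<in> M\<close> by blast
    moreover have "of_real (1 / n) \<le> labs c + ?w"
      using sup_ge1[of "- (labs c - of_real (1 / n))" 0]
      by (simp only: minus_diff_eq diff_le_eq add.commute)
    ultimately show False using l_ideal_of_real[OF Ml(1), of "1 / n"] n Ml(2) by simp
  qed
  then show ?thesis using M l_ideal_insert_superset[OF Jl] by blast
qed

subsection \<open>Residue fields of maximal \<open>\<ell>\<close>-ideals\<close>

lemma YspD: "M \<in> Ysp \<Longrightarrow> l_ideal M" "M \<in> Ysp \<Longrightarrow> M \<noteq> UNIV"
  "M \<in> Ysp \<Longrightarrow> l_ideal J \<Longrightarrow> M \<subseteq> J \<Longrightarrow> J = M \<or> J = UNIV"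
  unfolding Ysp_def by blast+

lemma Ysp_of_real_le:
  assumes "M \<in> Ysp" "of_real r \<le> a" "a \<in> M" shows "r \<le> 0"
proof (rule ccontr)
  assume "\<not> r \<le> 0"
  then have "M = UNIV" using l_ideal_of_real[OF YspD(1)[OF assms(1)] _ assms(2,3)] by simp
  then show False using YspD(2)[OF assms(1)] by contradiction
qed

text \<open>The quotient is totally ordered: if both parts were missing, adjoining the negative part
  would give an l-ideal strictly between \<open>M\<close> and the whole algebra.\<close>

lemma Ysp_pos_part_or_neg_part:
  assumes M: "M \<in> Ysp"
  shows "sup a 0 \<in> M \<or> sup (- a) 0 \<in> M"
proof (rule ccontr)
  assume neg: "\<not> ?thesis"
  note Ml = YspD(1)[OF M]
  let ?K = "l_ideal_insert M (sup (- a) 0)"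
  have "?K = M \<or> ?K = UNIV"
    by (intro YspD(3)[OF M] l_ideal_l_ideal_insert[OF Ml] l_ideal_insert_superset[OF Ml]) simp
  moreover have "sup (- a) 0 \<in> ?K" by (rule l_ideal_insert_mem[OF Ml]) simp
  moreover have "?K \<noteq> UNIV" using l_ideal_insert_neg_part_proper[OF Ml] neg by blast
  ultimately show False using neg by blast
qed

text \<open>The quotient has no nonzero infinitesimals: if \<open>c\<close> were outside
  \<open>M\<close>, maximality would give \<open>1 <= j + t c\<close> with \<open>j\<close> in
  \<open>M\<close>, which a small enough bound on \<open>c\<close> contradicts.\<close>

lemma Ysp_infinitesimal:
  fixes c :: "'a::bal_algebra"
  assumes M: "M \<in> Ysp" and c: "0 \<le> c"
    and small: "\<And>\<epsilon>. 0 < \<epsilon> \<Longrightarrow> \<exists>m\<in>M. c \<le> of_real \<epsilon> + m"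
  shows "c \<in> M"
proof (rule ccontr)
  assume "c \<notin> M"
  note Ml = YspD(1)[OF M]
  let ?K = "l_ideal_insert M c"
  have "?K = M \<or> ?K = UNIV"
    by (intro YspD(3)[OF M] l_ideal_l_ideal_insert[OF Ml] l_ideal_insert_superset[OF Ml] c)
  moreover have "c \<in> ?K" by (rule l_ideal_insert_mem[OF Ml c])
  ultimately have "1 \<in> ?K" using \<open>c \<notin> M\<close> by blast
  then obtain j t where j: "j \<in> M" "0 \<le> t" "1 \<le> j + t *\<^sub>R c"
    unfolding l_ideal_insert_def by (auto simp: labs_of_nonneg one_nonneg)
  \<comment> \<open>This forces \<open>t * \<epsilon> < 1\<close>; the summand 1 covers
    \<open>t = 0\<close>.\<close>
  define \<epsilon> where "\<epsilon> = 1 / (2 * (t + 1))"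
  have \<epsilon>: "0 < \<epsilon>" using j(2) by (simp add: \<epsilon>_def)
  then obtain m where m: "m \<in> M" "c \<le> of_real \<epsilon> + m" using small by blast
  have "1 \<le> j + t *\<^sub>R c" by fact
  also have "\<dots> \<le> j + t *\<^sub>R (of_real \<epsilon> + m)"
    using m(2) j(2) by (intro add_left_mono scaleR_left_mono)
  also have "\<dots> = (j + t *\<^sub>R m) + of_real (t * \<epsilon>)" by (simp add: algebra_simps scaleR_conv_of_real)
  finally have "of_real (1 - t * \<epsilon>) \<le> j + t *\<^sub>R m" by (simp add: diff_le_eq)
  moreover have "j + t *\<^sub>R m \<in> M" using j m by (intro l_ideal_add[OF Ml] l_ideal_scaleR[OF Ml])
  ultimately have "1 - t * \<epsilon> \<le> 0" by (rule Ysp_of_real_le[OF M])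
  moreover have "t * \<epsilon> < 1" using j(2) by (simp add: \<epsilon>_def field_simps)
  ultimately show False by simp
qed

text \<open>The residue is the supremum \<open>z\<close> of the cut of all reals below
  \<open>a\<close> modulo \<open>M\<close>; boundedness makes the cut nonempty and bounded, and
  \<open>a - z\<close> turns out to be infinitesimal modulo \<open>M\<close>.\<close>

lemma Ysp_residue_exists:
  fixes a :: "'a::bal_algebra"
  assumes M: "M \<in> Ysp"
  shows "\<exists>r. a - of_real r \<in> M"
proof -
  note Ml = YspD(1)[OF M]
  obtain n where n: "1 \<le> n" "a \<le> of_real n" "- of_real n \<le> a" using ex_real_bound by blast
  define S where "S = {r. negpart (a - of_real r) \<in> M}"
  have down: "s \<in> S" if "r \<in> S" "s \<le> r" for r s
  proof -
    have "negpart (a - of_real s) \<le> negpart (a - of_real r)"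
      unfolding negpart_def by (rule sup_mono) (use of_real_mono[OF that(2)] in auto)
    then show ?thesis using that(1) unfolding S_def mem_Collect_eq
      by (intro l_ideal_convex[OF Ml, of "negpart (a - of_real s)"]) (auto simp: negpart_def)
  qed
  have "- (a - of_real (- n)) \<le> 0" using n(3) by (simp add: minus_le_iff)
  then have "negpart (a - of_real (- n)) = 0" unfolding negpart_def by (rule sup_absorb2)
  then have "- n \<in> S" unfolding S_def using l_ideal_0[OF Ml] by simp
  have S_le: "r \<le> n" if "r \<in> S" for r
  proof -
    have "of_real (r - n) \<le> - (a - of_real r)" using n(2) by simp
    also have "\<dots> \<le> negpart (a - of_real r)" by (simp add: negpart_def)
    finally have "r - n \<le> 0" using that by (intro Ysp_of_real_le[OF M]) (auto simp: S_def)
    then show ?thesis by simp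
  qed
  then have bdd: "bdd_above S" by (auto simp: bdd_above_def)
  define z where "z = Sup S"
  have "labs (a - of_real z) \<in> M"
  proof (rule Ysp_infinitesimal[OF M labs_nonneg])
    fix \<epsilon> :: real assume \<epsilon>: "0 < \<epsilon>"
    \<comment> \<open>Totality of the quotient order turns this failure into
      \<open>a <= z + \<epsilon>\<close> modulo \<open>M\<close>; membership of
      \<open>z - \<epsilon>\<close> in the cut gives the lower estimate.\<close>
    have "z + \<epsilon> \<notin> S" using cSup_upper[OF _ bdd, of "z + \<epsilon>"] \<epsilon> by (auto simp: z_def)
    then have u: "sup (a - of_real (z + \<epsilon>)) 0 \<in> M"
      using Ysp_pos_part_or_neg_part[OF M, of "a - of_real (z + \<epsilon>)"]
      by (simp add: S_def negpart_def)
    obtain r where "r \<in> S" "z - \<epsilon> < r"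
      using less_cSupE[of "z - \<epsilon>" S] \<open>- n \<in> S\<close> \<epsilon> by (auto simp: z_def)
    then have "z - \<epsilon> \<in> S" using down by auto
    then have v: "sup (- (a - of_real (z - \<epsilon>))) 0 \<in> M" by (simp add: S_def negpart_def)
    let ?u = "sup (a - of_real (z + \<epsilon>)) 0" and ?v = "sup (- (a - of_real (z - \<epsilon>))) 0"
    have "a - of_real z = of_real \<epsilon> + (a - of_real (z + \<epsilon>))" by simp
    also have "\<dots> \<le> of_real \<epsilon> + (?u + ?v)"
      by (rule add_left_mono, rule order_trans[OF sup_ge1[of _ 0]], rule add_increasing2) auto
    finally have 1: "a - of_real z \<le> of_real \<epsilon> + (?u + ?v)" .
    have "- (a - of_real z) = of_real \<epsilon> + - (a - of_real (z - \<epsilon>))" by simp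
    also have "\<dots> \<le> of_real \<epsilon> + (?u + ?v)"
      by (rule add_left_mono, rule order_trans[OF sup_ge1[of _ 0]], rule add_increasing) auto
    finally have "labs (a - of_real z) \<le> of_real \<epsilon> + (?u + ?v)" using 1 by (simp only: labs_le_iff)
    then show "\<exists>m\<in>M. labs (a - of_real z) \<le> of_real \<epsilon> + m" using u v l_ideal_add[OF Ml] by blast
  qed
  then show ?thesis using l_ideal_labs[OF Ml] by blast
qed

lemma Ysp_residue_unique:
  assumes M: "M \<in> Ysp" and "a - of_real r \<in> M" "a - of_real s \<in> M"
  shows "r = s"
proof -
  have le: "r \<le> s" if "a - of_real r \<in> M" "a - of_real s \<in> M" for r s
  proof -
    have "(a - of_real s) - (a - of_real r) \<in> M" using that by (rule l_ideal_diff[OF YspD(1)[OF M], rotated])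
    then have "of_real (r - s) \<in> M" by simp
    then have "r - s \<le> 0" using Ysp_of_real_le[OF M order_refl] by blast
    then show ?thesis by simp
  qed
  show ?thesis using le[of r s] le[of s r] assms by simp
qed

lemma zeta_mem:
  assumes M: "M \<in> Ysp" shows "a - of_real (zeta a M) \<in> M"
proof -
  have "\<exists>!r. a - of_real r \<in> M" using Ysp_residue_exists[OF M] Ysp_residue_unique[OF M] by blast
  from theI'[OF this] show ?thesis using M by (simp add: zeta_def)
qed

lemma zeta_eqI: "M \<in> Ysp \<Longrightarrow> a - of_real r \<in> M \<Longrightarrow> zeta a M = r"
  by (rule Ysp_residue_unique[OF _ zeta_mem])

lemma zeta_add_of_real: "M \<in> Ysp \<Longrightarrow> zeta (a + of_real s) M = zeta a M + s"
  by (rule zeta_eqI) (simp_all add: zeta_mem)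

text \<open>The membership condition used in \<open>alpha\<close> and in the formula for gamma
  becomes an inequality between reals.\<close>

lemma negpart_mem_iff:
  assumes M: "M \<in> Ysp"
  shows "negpart (a - of_real r) \<in> M \<longleftrightarrow> r \<le> zeta a M"
proof
  note Ml = YspD(1)[OF M]
  let ?m = "a - of_real (zeta a M)"
  show "negpart (a - of_real r) \<in> M" if "r \<le> zeta a M"
    unfolding negpart_def
  proof (rule l_ideal_pos_part[OF Ml])
    show "- (a - of_real r) \<le> - ?m" using of_real_mono[OF that] by simp
    show "- ?m \<in> M" by (rule l_ideal_minus[OF Ml zeta_mem[OF M]])
  qed
  show "r \<le> zeta a M" if n: "negpart (a - of_real r) \<in> M"
  proof -
    have "of_real (r - zeta a M) = ?m + - (a - of_real r)" by simp
    also have "\<dots> \<le> ?m + negpart (a - of_real r)" unfolding negpart_def by (intro add_left_mono) simp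
    finally have "r - zeta a M \<le> 0"
      by (rule Ysp_of_real_le[OF M]) (intro l_ideal_add[OF Ml] zeta_mem[OF M] n)
    then show ?thesis by simp
  qed
qed

lemma zeta_mono:
  assumes M: "M \<in> Ysp" and "a \<le> b" shows "zeta a M \<le> zeta b M"
proof -
  have "negpart (b - of_real (zeta a M)) \<le> negpart (a - of_real (zeta a M))"
    unfolding negpart_def using assms(2) by (intro sup_mono) auto
  then have "negpart (b - of_real (zeta a M)) \<in> M"
    by (rule l_ideal_convex[OF YspD(1)[OF M], rotated])
      (auto simp: negpart_mem_iff[OF M], simp add: negpart_def)
  then show ?thesis by (simp add: negpart_mem_iff[OF M])
qed

lemma zeta_of_real: "M \<in> Ysp \<Longrightarrow> zeta (of_real r) M = r"
  by (rule zeta_eqI) (auto intro: l_ideal_0[OF YspD(1)])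

lemma zeta_in_BY: "zeta a \<in> BY"
proof -
  obtain n where n: "1 \<le> n" "a \<le> of_real n" "- of_real n \<le> a" using ex_real_bound by blast
  have "\<bar>zeta a M\<bar> \<le> n" if M: "M \<in> Ysp" for M
    using zeta_mono[OF M n(2)] zeta_mono[OF M, of "of_real (- n)" a] n(3)
      zeta_of_real[OF M, of n] zeta_of_real[OF M, of "- n"] by auto
  then show ?thesis unfolding BY_def by (auto simp: bounded_iff zeta_def)
qed

text \<open>Residues carry the order of the quotient to that of the reals, so the archimedean
  property of the reals is inherited.\<close>

lemma Ysp_subset_Xsp: "Ysp \<subseteq> Xsp"
proof
  fix M :: "'a set" assume M: "M \<in> Ysp"
  note Ml = YspD(1)[OF M]
  have "arch_ideal M" unfolding arch_ideal_def
  proof (intro conjI Ml allI impI)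
    fix a b :: 'a assume *: "\<forall>n::nat. n \<ge> 1 \<longrightarrow> quot_le M (of_nat n * a) b"
    have "real n * zeta a M \<le> zeta b M" if n: "n \<ge> 1" for n :: nat
    proof -
      obtain c where c: "c \<in> M" "of_nat n * a \<le> b + c" using * n by (auto simp: quot_le_def)
      have "zeta (of_nat n * a) M = real n * zeta a M"
        by (rule zeta_eqI[OF M])
          (use l_ideal_mult[OF Ml zeta_mem[OF M, of a], of "of_nat n"] in \<open>simp add: algebra_simps\<close>)
      moreover have "zeta (b + c) M = zeta b M"
        by (rule zeta_eqI[OF M])
          (use l_ideal_add[OF Ml zeta_mem[OF M, of b] c(1)] in \<open>simp add: algebra_simps\<close>)
      ultimately show ?thesis using zeta_mono[OF M c(2)] by simp
    qed
    then have bound: "real (Suc n) * zeta a M \<le> zeta b M" for n by (metis le_add1 plus_1_eq_Suc)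
    have "zeta a M \<le> 0"
    proof (rule ccontr)
      assume pos: "\<not> zeta a M \<le> 0"
      then obtain n where "zeta b M < real n * zeta a M" using reals_Archimedean3[of "zeta a M"] by auto
      also have "\<dots> \<le> real (Suc n) * zeta a M" using pos by (intro mult_right_mono) auto
      finally show False using bound[of n] by simp
    qed
    then have "negpart (- a - of_real 0) \<in> M"
      unfolding negpart_mem_iff[OF M]
      using zeta_eqI[OF M, of "- a" "- zeta a M"] l_ideal_minus[OF Ml zeta_mem[OF M, of a]] by simp
    then show "quot_le M a 0" unfolding quot_le_iff[OF Ml] by (simp add: negpart_def)
  qed
  then show "M \<in> Xsp" using YspD(2)[OF M] by (simp add: Xsp_def Arch_def)
qed

section \<open>The lattice of archimedean l-ideals\<close>

lemma ArchD: "I \<in> Arch \<Longrightarrow> l_ideal I" by (simp add: Arch_def arch_ideal_def)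

lemma Ysp_Arch: "M \<in> Ysp \<Longrightarrow> M \<in> Arch"
  using Ysp_subset_Xsp by (auto simp: Xsp_def)

lemma Arch_mem_iff: "I \<in> Arch \<Longrightarrow> c \<in> I \<longleftrightarrow> (\<forall>M\<in>Ysp. I \<subseteq> M \<longrightarrow> c \<in> M)"
  using arch_ideal_separation[of I c] by (auto simp: Arch_def)

lemma Xsp_ex_Ysp: "I \<in> Xsp \<Longrightarrow> \<exists>M\<in>Ysp. I \<subseteq> M"
  by (intro ex_maximal_l_ideal) (auto simp: Xsp_def Arch_def arch_ideal_def)

lemma Arch_UNIV: "UNIV \<in> Arch"
  by (simp add: Arch_def arch_ideal_def l_ideal_def ring_ideal_def quot_le_def)
    (metis add.left_neutral order_refl)

text \<open>By \<open>quot_le_iff\<close> the order relation modulo an intersection is the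
  conjunction of the relations modulo its members. This makes \<open>arch_join\<close> an
  archimedean l-ideal.\<close>

lemma Arch_Inter:
  assumes "F \<subseteq> Arch"
  shows "\<Inter>F \<in> Arch"
proof -
  have lF: "l_ideal K" if "K \<in> F" for K using assms that ArchD by blast
  have l: "l_ideal (\<Inter>F)" unfolding l_ideal_def ring_ideal_def
    using lF by (auto intro: l_ideal_0 l_ideal_add l_ideal_mult l_ideal_solid)
  show ?thesis unfolding Arch_def mem_Collect_eq arch_ideal_def
  proof (intro conjI l allI impI)
    fix a b :: 'a assume *: "\<forall>n::nat. n \<ge> 1 \<longrightarrow> quot_le (\<Inter>F) (of_nat n * a) b"
    have "sup (a - 0) 0 \<in> K" if K: "K \<in> F" for K
    proof -
      have "\<forall>n::nat. n \<ge> 1 \<longrightarrow> quot_le K (of_nat n * a) b" using * K unfolding quot_le_def by blast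
      then have "quot_le K a 0" using assms K unfolding Arch_def arch_ideal_def by blast
      then show ?thesis using quot_le_iff[OF lF[OF K]] by blast
    qed
    then show "quot_le (\<Inter>F) a 0" using quot_le_iff[OF l] by blast
  qed
qed

lemma Arch_Int: "I \<in> Arch \<Longrightarrow> J \<in> Arch \<Longrightarrow> I \<inter> J \<in> Arch"
  using Arch_Inter[of "{I, J}"] by simp

lemma Arch_arch_join: "arch_join I J \<in> Arch"
  unfolding arch_join_def by (rule Arch_Inter) auto

text \<open>Maximal l-ideals are archimedean and every proper archimedean l-ideal lies in one, so
  the join is proper exactly when some maximal l-ideal contains both \<open>J\<close> and
  \<open>I\<close>.\<close>

lemma arch_join_eq_UNIV_iff:
  "arch_join J I = UNIV \<longleftrightarrow> (\<forall>M\<in>Ysp. J \<subseteq> M \<longrightarrow> \<not> I \<subseteq> M)"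
proof
  assume U: "arch_join J I = UNIV"
  have False if "M \<in> Ysp" "J \<subseteq> M" "I \<subseteq> M" for M
  proof -
    have "arch_join J I \<subseteq> M" unfolding arch_join_def using that Ysp_Arch by (intro Inter_lower) auto
    then show False using U YspD(2)[OF that(1)] by auto
  qed
  then show "\<forall>M\<in>Ysp. J \<subseteq> M \<longrightarrow> \<not> I \<subseteq> M" by blast
next
  assume *: "\<forall>M\<in>Ysp. J \<subseteq> M \<longrightarrow> \<not> I \<subseteq> M"
  have "K = UNIV" if K: "K \<in> Arch" "J \<union> I \<subseteq> K" for K
  proof (rule ccontr)
    assume "K \<noteq> UNIV"
    then obtain M where M: "M \<in> Ysp" "K \<subseteq> M" using Xsp_ex_Ysp[of K] K by (auto simp: Xsp_def)
    then have "J \<subseteq> M" "I \<subseteq> M" using K(2) by (meson Un_subset_iff subset_trans)+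
    then show False using bspec[OF * M(1)] by simp
  qed
  then show "arch_join J I = UNIV" unfolding arch_join_def by (simp only: Inter_UNIV_conv) simp
qed

lemma Ysp_maximal: "M \<in> Ysp \<Longrightarrow> N \<in> Ysp \<Longrightarrow> M \<subseteq> N \<Longrightarrow> N = M"
  using YspD(3)[of M N] YspD(1,2)[of N] by simp

lemma arch_join_Ysp: "M \<in> Ysp \<Longrightarrow> arch_join M I = UNIV \<longleftrightarrow> \<not> I \<subseteq> M"
  unfolding arch_join_eq_UNIV_iff using Ysp_maximal[of M] by auto

lemma Arch_zero: "{0} \<in> (Arch :: 'a::bal_algebra set set)"
proof -
  have "l_ideal {0::'a}" unfolding l_ideal_def ring_ideal_def
    by (auto simp: labs_le_iff labs_def)
  moreover have "a \<le> 0" if "\<forall>n::nat. n \<ge> 1 \<longrightarrow> of_nat n * a \<le> b" for a b :: 'a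
    using that bal_archimedean by blast
  ultimately show ?thesis by (auto simp: Arch_def arch_ideal_def quot_le_def)
qed

lemma Ysp_nonempty: "(Ysp :: 'a::bal_algebra set set) \<noteq> {}"
proof -
  have "(1::'a) \<notin> {0}" by simp
  then have "{0::'a} \<noteq> UNIV" by (metis UNIV_I)
  then show ?thesis using ex_maximal_l_ideal[OF ArchD[OF Arch_zero]] by blast
qed

subsection \<open>Normal functions\<close>

text \<open>For \<open>I\<close> in \<open>Xsp\<close> this is the least open neighbourhood of
  \<open>I\<close>.\<close>

definition Xup :: "'a::bal_algebra set \<Rightarrow> 'a set set" where
  "Xup I = {J \<in> Xsp. I \<subseteq> J}"

definition Yup :: "'a::bal_algebra set \<Rightarrow> 'a set set" where
  "Yup I = {M \<in> Ysp. I \<subseteq> M}"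

lemma Yup_nonempty: "I \<in> Xsp \<Longrightarrow> Yup I \<noteq> {}"
  using Xsp_ex_Ysp by (auto simp: Yup_def)

lemma Yup_Ysp: "M \<in> Ysp \<Longrightarrow> Yup M = {M}"
  unfolding Yup_def using Ysp_maximal[of M] by auto

lemma Xup_Ysp: "M \<in> Ysp \<Longrightarrow> Xup M = {M}"
  unfolding Xup_def using YspD(3)[of M] Ysp_subset_Xsp by (auto simp: Xsp_def dest: ArchD)

lemma Xopen_Xup: "Xopen (Xup I)"
  unfolding Xopen_def Xup_def by blast

lemma mem_Xup: "I \<in> Xsp \<Longrightarrow> I \<in> Xup I"
  by (simp add: Xup_def)

text \<open>The supremum over all neighbourhoods is attained at the least one, because infima grow
  as the set shrinks.\<close>

lemma lower_env_eq:
  assumes f: "bounded (f ` Xsp)" and I: "I \<in> Xsp"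
  shows "lower_env f I = Inf (f ` Xup I)"
proof -
  have "Sup {Inf (f ` U) | U. Xopen U \<and> I \<in> U} = Inf (f ` Xup I)"
  proof (rule cSup_eq_maximum)
    show "Inf (f ` Xup I) \<in> {Inf (f ` U) | U. Xopen U \<and> I \<in> U}"
      using I Xopen_Xup[of I] mem_Xup by blast
    fix y assume "y \<in> {Inf (f ` U) | U. Xopen U \<and> I \<in> U}"
    then obtain U where U: "y = Inf (f ` U)" "Xopen U" "I \<in> U" by blast
    then have "Xup I \<subseteq> U" "U \<subseteq> Xsp" by (auto simp: Xopen_def Xup_def)
    moreover have "Xup I \<noteq> {}" using I by (auto simp: Xup_def)
    ultimately show "y \<le> Inf (f ` Xup I)" unfolding U(1)
      using bdd_below_mono[OF bounded_imp_bdd_below[OF f] image_mono, of U]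
      by (intro cInf_superset_mono) auto
  qed
  then show ?thesis using I by (simp add: lower_env_def)
qed

lemma upper_env_eq:
  assumes f: "bounded (f ` Xsp)" and I: "I \<in> Xsp"
  shows "upper_env f I = Sup (f ` Xup I)"
proof -
  have "Inf {Sup (f ` U) | U. Xopen U \<and> I \<in> U} = Sup (f ` Xup I)"
  proof (rule cInf_eq_minimum)
    show "Sup (f ` Xup I) \<in> {Sup (f ` U) | U. Xopen U \<and> I \<in> U}"
      using I Xopen_Xup[of I] mem_Xup by blast
    fix y assume "y \<in> {Sup (f ` U) | U. Xopen U \<and> I \<in> U}"
    then obtain U where U: "y = Sup (f ` U)" "Xopen U" "I \<in> U" by blast
    then have "Xup I \<subseteq> U" "U \<subseteq> Xsp" by (auto simp: Xopen_def Xup_def)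
    moreover have "Xup I \<noteq> {}" using I by (auto simp: Xup_def)
    ultimately show "Sup (f ` Xup I) \<le> y" unfolding U(1)
      using bdd_above_mono[OF bounded_imp_bdd_above[OF f] image_mono, of U]
      by (intro cSup_subset_mono) auto
  qed
  then show ?thesis using I by (simp add: upper_env_def)
qed

text \<open>A maximal \<open>M\<close> is an open point, so the upper envelope agrees with
  \<open>f\<close> there. At any other \<open>J\<close> the envelope dominates \<open>f\<close> at
  the maximal l-ideals above \<open>J\<close>, so the outer infimum is already determined on
  \<open>Yup I\<close>.\<close>

lemma nrm_eq:
  fixes f :: "'a::bal_algebra set \<Rightarrow> real"
  assumes f: "bounded (f ` Xsp)" and I: "I \<in> Xsp"
  shows "nrm f I = Inf (f ` Yup I)"
proof -
  obtain c where c: "\<And>J. J \<in> Xsp \<Longrightarrow> \<bar>f J\<bar> \<le> c" using f by (auto simp: bounded_iff)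
  have bdd: "bdd_above (f ` Xup J)" for J
    using c by (intro bdd_aboveI2[of _ _ c]) (fastforce simp: Xup_def)
  have le: "f M \<le> upper_env f J" if "M \<in> Xup J" "J \<in> Xsp" for M J
    unfolding upper_env_eq[OF f that(2)] using that bdd by (intro cSup_upper) auto
  have lb: "- c \<le> upper_env f J" if "J \<in> Xsp" for J
    using le[of J J] c[of J] that by (auto simp: Xup_def)
  have ub: "upper_env f J \<le> c" if "J \<in> Xsp" for J
    unfolding upper_env_eq[OF f that] using that c by (intro cSup_least) (fastforce simp: Xup_def)+
  have b: "bounded (upper_env f ` Xsp)"
    unfolding bounded_iff by (intro exI[of _ c]) (use lb ub in \<open>fastforce simp: abs_le_iff\<close>)
  have fu: "f M = upper_env f M" if "M \<in> Ysp" for M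
    using upper_env_eq[OF f, of M] Ysp_subset_Xsp that by (auto simp: Xup_Ysp)
  have YX: "Yup J \<subseteq> Xup J" for J :: "'a set" using Ysp_subset_Xsp by (auto simp: Yup_def Xup_def)
  have "Inf (upper_env f ` Xup I) = Inf (f ` Yup I)"
  proof (rule antisym)
    have "f ` Yup I = upper_env f ` Yup I" using fu by (auto simp: Yup_def)
    then show "Inf (upper_env f ` Xup I) \<le> Inf (f ` Yup I)"
      using Yup_nonempty[OF I] YX[of I] lb
      by (auto intro!: cInf_superset_mono bdd_belowI2[of _ "- c"] simp: Xup_def)
    show "Inf (f ` Yup I) \<le> Inf (upper_env f ` Xup I)"
    proof (rule cInf_greatest)
      show "upper_env f ` Xup I \<noteq> {}" using I by (auto simp: Xup_def)
      fix y assume "y \<in> upper_env f ` Xup I"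
      then obtain J where J: "y = upper_env f J" "J \<in> Xsp" "I \<subseteq> J" by (auto simp: Xup_def)
      obtain M where M: "M \<in> Yup J" using Yup_nonempty[OF J(2)] by blast
      have "Inf (f ` Yup I) \<le> f M"
        using M J(3) c Ysp_subset_Xsp
        by (intro cInf_lower bdd_belowI2[of _ "- c"]) (fastforce simp: Yup_def abs_le_iff)+
      also have "\<dots> \<le> y" unfolding J(1) using M YX J(2) by (intro le) auto
      finally show "Inf (f ` Yup I) \<le> y" .
    qed
  qed
  then show ?thesis unfolding nrm_def lower_env_eq[OF b I] .
qed

lemma nrm_outside: "I \<notin> Xsp \<Longrightarrow> nrm f I = 0"
  by (simp add: nrm_def lower_env_def)

lemma nrm_Ysp: "bounded (f ` Xsp) \<Longrightarrow> M \<in> Ysp \<Longrightarrow> nrm f M = f M"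
  using nrm_eq[of f M] Ysp_subset_Xsp by (auto simp: Yup_Ysp)

text \<open>Identities between normalizations thereby reduce to pointwise identities on the maximal
  l-ideals.\<close>

lemma nrm_cong_Ysp:
  assumes "bounded (f ` Xsp)" "bounded (g ` Xsp)" "\<And>M. M \<in> Ysp \<Longrightarrow> f M = g M"
  shows "nrm f = nrm g"
proof
  fix I
  have "f ` Yup I = g ` Yup I" using assms(3) by (auto simp: Yup_def intro!: image_cong)
  then show "nrm f I = nrm g I"
    by (cases "I \<in> Xsp") (simp_all add: nrm_eq[OF assms(1)] nrm_eq[OF assms(2)] nrm_outside)
qed

lemma nrm_in_NX:
  assumes f: "bounded (f ` Xsp)"
  shows "nrm f \<in> NX"
proof -
  obtain c where c: "\<And>J. J \<in> Xsp \<Longrightarrow> \<bar>f J\<bar> \<le> c" using f by (auto simp: bounded_iff)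
  have "\<bar>nrm f I\<bar> \<le> c" if I: "I \<in> Xsp" for I
    unfolding nrm_eq[OF f I]
    using Yup_nonempty[OF I] c Ysp_subset_Xsp by (intro cInf_abs_ge) (auto simp: Yup_def)
  then have b: "bounded (nrm f ` Xsp)" by (auto simp: bounded_iff)
  have "nrm f = nrm (nrm f)" by (rule nrm_cong_Ysp[OF f b]) (simp add: nrm_Ysp[OF f])
  then show ?thesis using b nrm_outside by (auto simp: NX_def BX_def)
qed

lemma NX_bounded: "f \<in> NX \<Longrightarrow> bounded (f ` Xsp)"
  and NX_nrm: "f \<in> NX \<Longrightarrow> nrm f = f"
  by (auto simp: NX_def BX_def)

text \<open>Members of \<open>BY\<close> vanish outside \<open>Ysp\<close>, so they can be
  normalized as functions on \<open>Xsp\<close>; this lets \<open>nrm\<close> serve as the inverse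
  of \<open>psi\<close>.\<close>

lemma BY_bounded: "g \<in> BY \<Longrightarrow> bounded (g ` Xsp)"
  unfolding BY_def bounded_iff by (auto, metis abs_zero abs_ge_zero order_trans)

lemma psi_nrm: "bounded (f ` Xsp) \<Longrightarrow> psi (nrm f) = psi f"
  by (auto simp: psi_def nrm_Ysp)

lemma psi_BY: "g \<in> BY \<Longrightarrow> psi g = g"
  by (auto simp: psi_def BY_def)

lemma psi_in_BY: "f \<in> NX \<Longrightarrow> psi f \<in> BY"
  using Ysp_subset_Xsp by (fastforce simp: NX_def BX_def BY_def psi_def bounded_iff)

lemma nrm_psi: "f \<in> NX \<Longrightarrow> nrm (psi f) = f"
  using nrm_cong_Ysp[of "psi f" f, OF BY_bounded[OF psi_in_BY] NX_bounded]
  by (simp add: NX_nrm psi_def)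

lemma bounded_pointwise:
  fixes f g :: "'s \<Rightarrow> real"
  assumes "bounded (f ` S)" "bounded (g ` S)"
  shows "bounded ((\<lambda>x. f x + g x) ` S)" "bounded ((\<lambda>x. f x * g x) ` S)"
    "bounded ((\<lambda>x. max (f x) (g x)) ` S)" "bounded ((\<lambda>x. min (f x) (g x)) ` S)"
proof -
  obtain b where b: "\<And>x. x \<in> S \<Longrightarrow> \<bar>f x\<bar> \<le> b" using assms(1) by (auto simp: bounded_iff)
  obtain c where c: "\<And>x. x \<in> S \<Longrightarrow> \<bar>g x\<bar> \<le> c" using assms(2) by (auto simp: bounded_iff)
  have "\<bar>f x + g x\<bar> \<le> b + c" "\<bar>f x * g x\<bar> \<le> b * c"
    "\<bar>max (f x) (g x)\<bar> \<le> b + c" "\<bar>min (f x) (g x)\<bar> \<le> b + c" if "x \<in> S" for x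
    using b[OF that] c[OF that] by (auto simp: abs_mult intro!: mult_mono)
  then show "bounded ((\<lambda>x. f x + g x) ` S)" "bounded ((\<lambda>x. f x * g x) ` S)"
    "bounded ((\<lambda>x. max (f x) (g x)) ` S)" "bounded ((\<lambda>x. min (f x) (g x)) ` S)"
    unfolding bounded_iff by (auto, blast+)
qed

lemma bounded_chiX: "bounded (chiX U ` Xsp)"
  by (auto simp: bounded_iff chiX_def intro!: exI[of _ 1])

lemma bounded_scale: "bounded (f ` S) \<Longrightarrow> bounded ((\<lambda>x. r * f x :: real) ` S)"
  using bounded_pointwise(2)[of "\<lambda>_. r" S f] by (auto simp: bounded_iff)

text \<open>Normalization does not change values at maximal l-ideals, so after restriction the
  normalized operations are the pointwise ones.\<close>

lemma iso_NY_psi: "iso_NY psi"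
  unfolding iso_NY_def
proof (intro conjI ballI allI)
  show "bij_betw psi NX BY"
    by (rule bij_betw_byWitness[where f' = nrm])
      (auto simp: nrm_psi psi_nrm BY_bounded psi_BY psi_in_BY nrm_in_NX)
  fix f g :: "'a set \<Rightarrow> real" and r :: real
  assume f: "f \<in> NX"
  show "psi (nrm (\<lambda>I. r * f I)) = (\<lambda>M. r * psi f M)"
    unfolding psi_nrm[OF bounded_scale[OF NX_bounded[OF f]]] by (auto simp: psi_def)
  assume g: "g \<in> NX"
  note b = bounded_pointwise[OF NX_bounded[OF f] NX_bounded[OF g]]
  show "psi (nrm (\<lambda>I. f I + g I)) = (\<lambda>M. psi f M + psi g M)"
    "psi (nrm (\<lambda>I. f I * g I)) = (\<lambda>M. psi f M * psi g M)"
    "psi (nrm (\<lambda>I. max (f I) (g I))) = (\<lambda>M. max (psi f M) (psi g M))"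
    "psi (nrm (\<lambda>I. min (f I) (g I))) = (\<lambda>M. min (psi f M) (psi g M))"
    unfolding b[THEN psi_nrm] by (auto simp: psi_def)
next
  show "psi (nrm (chiX Xsp)) = chiY Ysp"
    unfolding psi_nrm[OF bounded_chiX] using Ysp_subset_Xsp
    by (intro ext) (auto simp: psi_def chiX_def chiY_def)
qed

subsection \<open>Evaluation of polynomials\<close>

definition monom_eval :: "('b \<Rightarrow> 'd::comm_ring_1) \<Rightarrow> ('b \<Rightarrow>\<^sub>0 nat) \<Rightarrow> 'd" where
  "monom_eval x m = (\<Prod>v\<in>Poly_Mapping.keys m. x v ^ Poly_Mapping.lookup m v)"

text \<open>Enlarging the support gives two monomials a common index set, over which they can be
  multiplied factor by factor.\<close>

lemma monom_eval_superset:
  assumes "finite S" "Poly_Mapping.keys m \<subseteq> S"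
  shows "monom_eval x m = (\<Prod>v\<in>S. x v ^ Poly_Mapping.lookup m v)"
  unfolding monom_eval_def using assms
  by (intro prod.mono_neutral_left) (auto simp: in_keys_iff)

lemma monom_eval_add: "monom_eval x (m + n) = monom_eval x m * monom_eval x n"
proof -
  let ?S = "Poly_Mapping.keys m \<union> Poly_Mapping.keys n"
  have "Poly_Mapping.keys (m + n) \<subseteq> ?S" by (rule keys_add)
  then show ?thesis
    by (simp add: monom_eval_superset[of ?S] lookup_add power_add prod.distrib)
qed

lemma peval_superset:
  assumes "finite S" "Poly_Mapping.keys p \<subseteq> S"
  shows "peval x p = (\<Sum>m\<in>S. Poly_Mapping.lookup p m *\<^sub>R monom_eval x m)"
  unfolding peval_def monom_eval_def[symmetric] using assms
  by (intro sum.mono_neutral_left) (auto simp: in_keys_iff)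

lemma peval_add: "peval x (p + q) = peval x p + peval x q"
proof -
  let ?S = "Poly_Mapping.keys p \<union> Poly_Mapping.keys q"
  have "Poly_Mapping.keys (p + q) \<subseteq> ?S" by (rule keys_add)
  then show ?thesis
    by (simp add: peval_superset[of ?S] lookup_add scaleR_add_left sum.distrib)
qed

lemma peval_diff: "peval x (p - q) = peval x p - peval x q"
  using peval_add[of x "p - q" q] by simp

lemma peval_single: "peval x (Poly_Mapping.single m c) = c *\<^sub>R monom_eval x m"
  by (simp add: peval_superset[of "{m}"])

lemma peval_0: "peval x 0 = 0"
  by (simp add: peval_def)

lemma peval_sum: "peval x (\<Sum>i\<in>S. f i) = (\<Sum>i\<in>S. peval x (f i))"
  by (induction S rule: infinite_finite_induct) (simp_all add: peval_0 peval_add)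

lemma sum_single_keys:
  "(\<Sum>m\<in>Poly_Mapping.keys p. Poly_Mapping.single m (Poly_Mapping.lookup p m)) = p"
  by (rule poly_mapping_eqI) (simp add: lookup_sum lookup_single when_def in_keys_iff)

lemma peval_mult: "peval x (p * q) = peval x p * peval x q"
proof -
  let ?c = Poly_Mapping.lookup
  let ?P = "Poly_Mapping.keys p" and ?Q = "Poly_Mapping.keys q"
  have "p * q = (\<Sum>m\<in>?P. Poly_Mapping.single m (?c p m)) * (\<Sum>n\<in>?Q. Poly_Mapping.single n (?c q n))"
    by (simp add: sum_single_keys)
  also have "peval x \<dots> = (\<Sum>m\<in>?P. \<Sum>n\<in>?Q. (?c p m * ?c q n) *\<^sub>R (monom_eval x m * monom_eval x n))"
    by (simp add: sum_product mult_single peval_sum peval_single monom_eval_add)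
  also have "\<dots> = peval x p * peval x q"
    by (simp add: peval_superset[OF _ order_refl] sum_product mult.commute)
  finally show ?thesis .
qed

lemma peval_1: "peval x 1 = 1"
  using peval_single[of x 0 1] by (simp add: monom_eval_def flip: single_one)

lemma peval_pvar: "peval x (pvar b) = x b"
  by (simp add: pvar_def peval_single monom_eval_superset[of "{b}"])

lemma ring_ideal_peval_kernel: "ring_ideal {p. peval x p = 0}"
  by (simp add: ring_ideal_def peval_0 peval_add peval_mult)

text \<open>\<open>top\<close> and joins come from \<open>bot\<close>, complements and meets by De
  Morgan, which spares every induction two cases.\<close>

lemma bool_generated_induct:
  assumes "b \<in> bool_generated S" "\<And>s. s \<in> S \<Longrightarrow> P s" "P bot"
    "\<And>x. P x \<Longrightarrow> P (- x)" "\<And>x y. P x \<Longrightarrow> P y \<Longrightarrow> P (inf x y)"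
  shows "P b"
proof -
  have top: "P top" using assms(4)[OF assms(3)] by simp
  have sup: "P (sup x y)" if "P x" "P y" for x y
    using assms(4)[OF assms(5)[OF assms(4)[OF that(1)] assms(4)[OF that(2)]]] by simp
  show ?thesis using assms(1) unfolding bool_generated_def
    by (rule InterD[where X = "Collect P", simplified mem_Collect_eq])
      (use assms top sup in auto)
qed

subsection \<open>The Dedekind completion\<close>

locale bal_completion =
  fixes e :: "'a::bal_algebra set \<Rightarrow> 'b::boolean_algebra"
    and x :: "'b \<Rightarrow> 'd::bal_algebra"
  assumes e: "free_bool_ext e"
    and x: "dedekind_completion_RB x"
begin

section \<open>Atoms of the free boolean extension\<close>

lemma e_inf: "I \<in> Arch \<Longrightarrow> J \<in> Arch \<Longrightarrow> e (I \<inter> J) = inf (e I) (e J)"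
  and e_sup: "I \<in> Arch \<Longrightarrow> J \<in> Arch \<Longrightarrow> e (arch_join I J) = sup (e I) (e J)"
  and e_zero: "e {0} = bot" and e_UNIV: "e UNIV = top"
  and e_inj: "inj_on e Arch" and e_gen: "bool_generated (e ` Arch) = UNIV"
  using e unfolding free_bool_ext_def by blast+

lemma e_mono: "I \<in> Arch \<Longrightarrow> J \<in> Arch \<Longrightarrow> I \<subseteq> J \<Longrightarrow> e I \<le> e J"
  using e_inf[of I J] by (simp add: Int_absorb2 le_iff_inf)

definition atom :: "'a set \<Rightarrow> 'b" where
  "atom M = - e M"

text \<open>For \<open>M\<close> in \<open>Ysp\<close> this is the two-valued homomorphism of the
  principal ultrafilter at \<open>atom M\<close>, with real values so that polynomials can be
  evaluated along it.\<close>

definition val :: "'a set \<Rightarrow> 'b \<Rightarrow> real" where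
  "val M b = (if atom M \<le> b then 1 else 0)"

lemma atom_nonzero: "M \<in> Ysp \<Longrightarrow> atom M \<noteq> bot"
  using inj_onD[OF e_inj, of M UNIV] e_UNIV Ysp_Arch[of M] Arch_UNIV YspD(2)[of M]
  by (auto simp: atom_def compl_eq_compl_iff[of "e M" top, simplified])

text \<open>In the second case \<open>M\<close> and \<open>I\<close> join to the whole algebra,
  which \<open>e\<close> sends to \<open>top\<close>.\<close>

lemma atom_le_e:
  assumes M: "M \<in> Ysp" and I: "I \<in> Arch"
  shows "I \<subseteq> M \<Longrightarrow> atom M \<le> - e I" "\<not> I \<subseteq> M \<Longrightarrow> atom M \<le> e I"
proof -
  show "atom M \<le> - e I" if "I \<subseteq> M" using e_mono[OF I Ysp_Arch[OF M] that] by (simp add: atom_def)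
  assume "\<not> I \<subseteq> M"
  then have "sup (e M) (e I) = top"
    using arch_join_Ysp[OF M, of I] e_sup[OF Ysp_Arch[OF M] I] e_UNIV by simp
  then show "atom M \<le> e I" by (simp add: sup_shunt atom_def)
qed

text \<open>The generators are decided by \<open>atom_le_e\<close>, and being decided is stable
  under complements and meets.\<close>

lemma atom_decides:
  assumes M: "M \<in> Ysp" shows "atom M \<le> b \<or> atom M \<le> - b"
proof (rule bool_generated_induct[of b "e ` Arch"])
  show "b \<in> bool_generated (e ` Arch)" using e_gen by simp
  show "\<And>s. s \<in> e ` Arch \<Longrightarrow> atom M \<le> s \<or> atom M \<le> - s" using atom_le_e[OF M] by blast
  show "atom M \<le> bot \<or> atom M \<le> - bot" by simp
  show "\<And>y. atom M \<le> y \<or> atom M \<le> - y \<Longrightarrow> atom M \<le> - y \<or> atom M \<le> - (- y)" by auto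
  show "\<And>y z. atom M \<le> y \<or> atom M \<le> - y \<Longrightarrow> atom M \<le> z \<or> atom M \<le> - z \<Longrightarrow>
      atom M \<le> inf y z \<or> atom M \<le> - inf y z"
    by (auto simp: le_supI1 le_supI2)
qed

lemma atom_le_compl_iff: "M \<in> Ysp \<Longrightarrow> atom M \<le> - b \<longleftrightarrow> \<not> atom M \<le> b"
  using atom_decides[of M b] atom_nonzero[of M] le_infI[of "atom M" b "- b"] by (auto simp: bot_unique)

lemma val_e: "M \<in> Ysp \<Longrightarrow> I \<in> Arch \<Longrightarrow> val M (e I) = (if I \<subseteq> M then 0 else 1)"
  using atom_le_e[of M I] atom_le_compl_iff[of M "e I"] by (auto simp: val_def)

lemma val_inf: "val M (inf b c) = val M b * val M c"
  by (auto simp: val_def)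

lemma val_compl: "M \<in> Ysp \<Longrightarrow> val M (- b) = 1 - val M b"
  by (simp add: val_def atom_le_compl_iff)

lemma val_bot: "M \<in> Ysp \<Longrightarrow> val M bot = 0"
  by (simp add: val_def bot_unique atom_nonzero)

lemma val_sup: "M \<in> Ysp \<Longrightarrow> val M (sup b c) = val M b + val M c - val M b * val M c"
  using val_compl[of M "inf (- b) (- c)"] val_compl[of M b] val_compl[of M c]
  by (simp add: val_inf algebra_simps)

text \<open>Below \<open>b\<close> there is a nonzero element of the form
  \<open>inf (e I) (- e J)\<close>. Being nonzero, it forces \<open>I\<close> not to lie in
  \<open>J\<close>, and separation then yields a maximal l-ideal above \<open>J\<close> that does
  not contain \<open>I\<close>.\<close>

lemma atom_below:
  assumes "b \<noteq> bot" shows "\<exists>M\<in>Ysp. atom M \<le> b"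
proof -
  define K where "K = {inf (e I) (- e J) | I J. I \<in> Arch \<and> J \<in> Arch}"
  have eK: "e I \<in> K" "- e I \<in> K" if "I \<in> Arch" for I
  proof -
    have "e I = inf (e I) (- e {0})" by (simp add: e_zero)
    moreover have "- e I = inf (e UNIV) (- e I)" by (simp add: e_UNIV)
    ultimately show "e I \<in> K" "- e I \<in> K" unfolding K_def using that Arch_zero Arch_UNIV by blast+
  qed
  have Kinf: "inf k l \<in> K" if kl: "k \<in> K" "l \<in> K" for k l
  proof -
    obtain I J I' J' where *: "I \<in> Arch" "J \<in> Arch" "I' \<in> Arch" "J' \<in> Arch"
      "k = inf (e I) (- e J)" "l = inf (e I') (- e J')" using kl unfolding K_def by blast
    have "inf k l = inf (e (I \<inter> I')) (- e (arch_join J J'))"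
      using * by (simp add: e_inf e_sup inf_aci)
    then show ?thesis unfolding K_def using * Arch_Int Arch_arch_join by blast
  qed
  \<comment> \<open>\<open>P b\<close> expresses that the members of \<open>K\<close> deciding \<open>b\<close> cover the top element. This form of the
    disjunctive normal form is closed under complements and meets without finite joins.\<close>
  define P where "P b = (\<forall>g. g \<noteq> bot \<longrightarrow> (\<exists>k\<in>K. inf k g \<noteq> bot \<and> (k \<le> b \<or> k \<le> - b)))" for b
  have "P b"
  proof (rule bool_generated_induct[of b "e ` Arch"])
    show "b \<in> bool_generated (e ` Arch)" using e_gen by simp
    show "P s" if s: "s \<in> e ` Arch" for s
    proof -
      obtain I where I: "I \<in> Arch" "s = e I" using s by blast
      have "inf s g \<noteq> bot \<or> inf (- s) g \<noteq> bot" if "g \<noteq> bot" for g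
        using that inf_sup_distrib2[of s "- s" g] by auto
      then show ?thesis unfolding P_def using eK[OF I(1)] I(2) by blast
    qed
    show "P bot" unfolding P_def using eK(1)[OF Arch_UNIV] e_UNIV by (auto intro!: bexI[of _ top])
    show "P (- y)" if "P y" for y using that unfolding P_def by auto
    show "P (inf y z)" if y: "P y" and z: "P z" for y z
      unfolding P_def
    proof (intro allI impI)
      fix g :: 'b assume "g \<noteq> bot"
      then obtain k where k: "k \<in> K" "inf k g \<noteq> bot" "k \<le> y \<or> k \<le> - y" using y unfolding P_def by blast
      \<comment> \<open>Searching inside \<open>inf k g\<close> instead of \<open>g\<close> keeps
        the meet of both deciding elements nonzero on \<open>g\<close>.\<close>
      then obtain l where l: "l \<in> K" "inf l (inf k g) \<noteq> bot" "l \<le> z \<or> l \<le> - z"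
        using z unfolding P_def by blast
      have "inf k l \<le> inf y z \<or> inf k l \<le> - inf y z"
        using k(3) l(3) by (auto intro: le_infI1 le_infI2 le_supI1 le_supI2)
      moreover have "inf (inf k l) g \<noteq> bot" using l(2) by (simp add: inf_aci)
      ultimately show "\<exists>k\<in>K. inf k g \<noteq> bot \<and> (k \<le> inf y z \<or> k \<le> - inf y z)"
        using Kinf[OF k(1) l(1)] by blast
    qed
  qed
  then obtain k where k: "k \<in> K" "inf k b \<noteq> bot" "k \<le> b \<or> k \<le> - b"
    using assms unfolding P_def by blast
  have kb: "k \<le> b" using k(2,3) by (metis inf_shunt)
  obtain I J where IJ: "I \<in> Arch" "J \<in> Arch" "k = inf (e I) (- e J)" using k(1) unfolding K_def by blast
  have "\<not> I \<subseteq> J"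
  proof
    assume "I \<subseteq> J"
    then have "e I \<le> e J" using IJ e_mono by blast
    then have "k = bot" using IJ(3) by (metis inf_shunt double_compl)
    then show False using k(2) by simp
  qed
  then obtain c where "c \<in> I" "c \<notin> J" by blast
  then obtain M where M: "M \<in> Ysp" "J \<subseteq> M" "\<not> I \<subseteq> M" using Arch_mem_iff[OF IJ(2), of c] by blast
  have "atom M \<le> k" unfolding IJ(3) using atom_le_e[OF M(1)] IJ M by simp
  then show ?thesis using kb M(1) by (meson order_trans)
qed

section \<open>Idempotents and their linear combinations\<close>

lemma peval_kernel: "peval x p = 0 \<longleftrightarrow> p \<in> ideal_gen RB_rels"
  using x unfolding dedekind_completion_RB_def by blast

lemma peval_rel: "p \<in> RB_rels \<Longrightarrow> peval x p = 0"
  unfolding peval_kernel ideal_gen_def by blast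

lemma x_inf: "x (inf b c) = x b * x c"
proof -
  have "peval x (pvar (inf b c) - pvar b * pvar c) = 0" by (rule peval_rel) (auto simp: RB_rels_def)
  then show ?thesis by (simp add: peval_diff peval_mult peval_pvar)
qed

lemma x_compl: "x (- b) = 1 - x b"
proof -
  have "peval x (pvar (- b) - (1 - pvar b)) = 0" by (rule peval_rel) (auto simp: RB_rels_def)
  then show ?thesis by (simp add: peval_diff peval_1 peval_pvar)
qed

lemma x_bot: "x bot = 0"
proof -
  have "peval x (pvar bot) = 0" by (rule peval_rel) (auto simp: RB_rels_def)
  then show ?thesis by (simp add: peval_pvar)
qed

lemma x_top: "x top = 1"
  using x_compl[of bot] by (simp add: x_bot)

lemma x_idem: "x b * x b = x b"
  using x_inf[of b b] by simp

lemma x_nonneg: "0 \<le> x b"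
  using square_nonneg[of "x b"] by (simp add: x_idem)

text \<open>The kernel of \<open>peval x\<close> contains nothing beyond the ideal of relations.
  Evaluation along \<open>val M\<close> satisfies all relations, so it kills this ideal, yet it
  sends the variable of the atom to 1.\<close>

lemma x_atom_nonzero:
  assumes M: "M \<in> Ysp" shows "x (atom M) \<noteq> 0"
proof
  assume "x (atom M) = 0"
  then have "pvar (atom M) \<in> ideal_gen RB_rels"
    using peval_kernel[of "pvar (atom M)"] by (simp add: peval_pvar)
  moreover have "RB_rels \<subseteq> {p. peval (val M) p = 0}"
    unfolding RB_rels_def using val_inf[of M] val_compl[OF M] val_bot[OF M] val_sup[OF M]
    by (auto simp: peval_diff peval_add peval_mult peval_1 peval_pvar)
  ultimately have "peval (val M) (pvar (atom M)) = 0"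
    unfolding ideal_gen_def using ring_ideal_peval_kernel[of "val M"] by blast
  then show False by (simp add: peval_pvar val_def)
qed

lemma x_mult_atom:
  assumes M: "M \<in> Ysp" shows "x b * x (atom M) = val M b *\<^sub>R x (atom M)"
proof (cases "atom M \<le> b")
  case True
  then show ?thesis using x_inf[of b "atom M"] by (simp add: val_def inf_absorb2)
next
  case False
  then have "inf (atom M) b = bot" using atom_le_compl_iff[OF M, of b] by (simp add: inf_shunt)
  then show ?thesis using x_inf[of "atom M" b] False by (simp add: val_def x_bot mult.commute)
qed

text \<open>Products of the idempotents are idempotents of meets, so each monomial collapses to a
  single \<open>x c\<close>; the monomials of \<open>p\<close> remain as indices.\<close>

lemma peval_x_representation:
  "\<exists>(K::('b \<Rightarrow>\<^sub>0 nat) set) c B. finite K \<and> peval x p = (\<Sum>k\<in>K. c k *\<^sub>R x (B k))"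
proof -
  have pow: "\<exists>c. x b ^ n = x c" for b and n :: nat
    by (induction n) (metis power_0 x_top, metis power_Suc x_inf)
  have "\<exists>c. (\<Prod>v\<in>S. x v ^ f v) = x c" if "finite S" for S and f :: "'b \<Rightarrow> nat"
    using that by (induction S) (simp, metis x_top, simp, metis pow x_inf)
  then have "\<exists>c. monom_eval x m = x c" for m unfolding monom_eval_def by simp
  then obtain B where "\<And>m. monom_eval x m = x (B m)" by metis
  then have "peval x p = (\<Sum>k\<in>Poly_Mapping.keys p. Poly_Mapping.lookup p k *\<^sub>R x (B k))"
    by (simp add: peval_superset[OF _ order_refl])
  then show ?thesis using finite_keys by blast
qed

text \<open>An inequality in the copy of \<open>R[B]\<close> is tested on atoms. The induction
  splits \<open>g\<close> by \<open>B k\<close>: on \<open>inf g (B k)\<close> the coefficient is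
  absorbed into the constant \<open>t\<close>, on the rest the term disappears. Once no terms
  remain, an atom below a nonzero \<open>g\<close> gives \<open>t <= 0\<close>.\<close>

lemma combination_le_0:
  assumes "finite K"
    and "\<And>M. M \<in> Ysp \<Longrightarrow> atom M \<le> g \<Longrightarrow> t + (\<Sum>k\<in>K. c k * val M (B k)) \<le> 0"
  shows "x g * (of_real t + (\<Sum>k\<in>K. c k *\<^sub>R x (B k))) \<le> 0"
  using assms
proof (induction K arbitrary: t g rule: finite_induct)
  case empty
  show ?case
  proof (cases "g = bot")
    case True then show ?thesis by (simp add: x_bot)
  next
    case False
    then obtain M where "M \<in> Ysp" "atom M \<le> g" using atom_below by blast
    then have "t \<le> 0" using empty by force
    then have "of_real t \<le> (0::'d)" using of_real_mono[of t 0] by simp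
    from mult_left_mono[OF this x_nonneg[of g]] show ?thesis by simp
  qed
next
  case (insert k K)
  let ?b = "B k" and ?s = "\<Sum>k\<in>K. c k *\<^sub>R x (B k)"
  have "x (inf g ?b) * (of_real (t + c k) + ?s) \<le> 0"
  proof (rule insert.IH)
    fix M assume "M \<in> Ysp" "atom M \<le> inf g ?b"
    then show "t + c k + (\<Sum>k\<in>K. c k * val M (B k)) \<le> 0"
      using insert.prems[of M] insert.hyps by (simp add: val_def[of M ?b])
  qed
  moreover have "x (inf g (- ?b)) * (of_real t + ?s) \<le> 0"
  proof (rule insert.IH)
    fix M assume "M \<in> Ysp" "atom M \<le> inf g (- ?b)"
    then show "t + (\<Sum>k\<in>K. c k * val M (B k)) \<le> 0"
      using insert.prems[of M] insert.hyps by (simp add: val_def[of M ?b] atom_le_compl_iff)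
  qed
  ultimately have "x (inf g ?b) * (of_real (t + c k) + ?s) + x (inf g (- ?b)) * (of_real t + ?s) \<le> 0"
    by (simp add: add_nonpos_nonpos)
  also have "x (inf g ?b) * (of_real (t + c k) + ?s) + x (inf g (- ?b)) * (of_real t + ?s)
    = x g * (of_real t + (of_real (c k) * (x ?b) + ?s))"
    using x_idem[of ?b] by (simp add: x_inf x_compl algebra_simps)
  finally show ?case using insert.hyps by (simp add: scaleR_conv_of_real)
qed

section \<open>Coordinates at maximal l-ideals\<close>

definition coord :: "'d \<Rightarrow> 'a set \<Rightarrow> real" where
  "coord d M = (if M \<in> Ysp then (THE r. d * x (atom M) = r *\<^sub>R x (atom M)) else 0)"

lemma scaleR_atom_le:
  assumes M: "M \<in> Ysp" and le: "r *\<^sub>R x (atom M) \<le> s *\<^sub>R x (atom M)"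
  shows "r \<le> s"
proof (rule ccontr)
  assume "\<not> r \<le> s"
  then have rs: "0 < r - s" by simp
  have "(r - s) *\<^sub>R x (atom M) \<le> (r - s) *\<^sub>R 0" using le by (simp add: scaleR_diff_left)
  then have "x (atom M) \<le> 0" by (rule scaleR_le_cancel[OF rs])
  then show False using x_nonneg[of "atom M"] x_atom_nonzero[OF M] by (simp add: order_antisym)
qed

lemma coord_eqI:
  assumes "M \<in> Ysp" "d * x (atom M) = r *\<^sub>R x (atom M)" shows "coord d M = r"
  unfolding coord_def using assms x_atom_nonzero[OF assms(1)] by auto

text \<open>The coordinate of a dense element below \<open>d\<close> is at most \<open>r\<close>, so \<open>d\<close> lies below
  \<open>r p + n (1 - p)\<close>, where \<open>p\<close> is the atom and \<open>n\<close> a bound of \<open>d\<close>.\<close>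
lemma coord_exists:
  assumes M: "M \<in> Ysp" shows "\<exists>r. d * x (atom M) = r *\<^sub>R x (atom M)"
proof -
  let ?p = "x (atom M)"
  have p0: "0 \<le> ?p" and q0: "0 \<le> 1 - ?p" using x_nonneg[of "e M"] x_nonneg[of "- e M"] x_compl[of "e M"]
    by (simp_all add: atom_def)
  define S where "S = {y \<in> range (peval x). y \<le> d}"
  have lub: "is_lub S d" using x unfolding dedekind_completion_RB_def S_def by blast
  have "\<exists>r. peval x q * ?p = r *\<^sub>R ?p" for q
  proof -
    obtain K c B where "peval x q = (\<Sum>k\<in>(K::('b \<Rightarrow>\<^sub>0 nat) set). c k *\<^sub>R x (B k))"
      using peval_x_representation by blast
    then have "peval x q * ?p = (\<Sum>k\<in>K. c k * val M (B k)) *\<^sub>R ?p"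
      by (simp add: sum_distrib_right x_mult_atom[OF M] scaleR_sum_left)
    then show ?thesis by blast
  qed
  then have "\<forall>y\<in>S. \<exists>r. y * ?p = r *\<^sub>R ?p" unfolding S_def by auto
  from bchoice[OF this] obtain \<rho> where \<rho>: "\<And>y. y \<in> S \<Longrightarrow> y * ?p = \<rho> y *\<^sub>R ?p" by blast
  obtain n where n: "1 \<le> n" "d \<le> of_real n" "- of_real n \<le> d" using ex_real_bound by blast
  \<comment> \<open>Constants belong to the copy of \<open>R[B]\<close>; this one shows that
    \<open>S\<close> is nonempty, so its coordinates have a supremum.\<close>
  have "peval x (pconst (- n)) = of_real (- n)"
    by (simp add: pconst_def peval_single monom_eval_def of_real_def)
  then have nS: "of_real (- n) \<in> S" using n(3) unfolding S_def
    by (metis (mono_tags, lifting) mem_Collect_eq of_real_minus rangeI)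
  have \<rho>_le: "\<rho> y \<le> n" if y: "y \<in> S" for y
  proof (rule scaleR_atom_le[OF M])
    have "y \<le> of_real n" using y n(2) unfolding S_def by auto
    from mult_right_mono[OF this p0] show "\<rho> y *\<^sub>R ?p \<le> n *\<^sub>R ?p"
      using \<rho>[OF y] by (simp add: scaleR_conv_of_real)
  qed
  then have bdd: "bdd_above (\<rho> ` S)" by (auto simp: bdd_above_def)
  define r where "r = Sup (\<rho> ` S)"
  have "d \<le> r *\<^sub>R ?p + n *\<^sub>R (1 - ?p)"
  proof -
    have "y \<le> r *\<^sub>R ?p + n *\<^sub>R (1 - ?p)" if y: "y \<in> S" for y
    proof -
      have "y = y * ?p + y * (1 - ?p)" by (simp add: algebra_simps)
      also have "\<dots> \<le> r *\<^sub>R ?p + n *\<^sub>R (1 - ?p)"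
      proof (rule add_mono)
        show "y * ?p \<le> r *\<^sub>R ?p" unfolding \<rho>[OF y] r_def
          using cSup_upper[OF imageI[OF y] bdd] by (rule scaleR_right_mono[OF _ p0])
        have "y \<le> of_real n" using y n(2) unfolding S_def by auto
        from mult_right_mono[OF this q0] show "y * (1 - ?p) \<le> n *\<^sub>R (1 - ?p)"
          by (simp add: scaleR_conv_of_real)
      qed
      finally show ?thesis .
    qed
    then show ?thesis using lub unfolding is_lub_def by blast
  qed
  from mult_right_mono[OF this p0] have "d * ?p \<le> r *\<^sub>R ?p"
    using x_idem[of "atom M"] by (simp add: algebra_simps)
  moreover have "r *\<^sub>R ?p \<le> d * ?p"
  proof -
    \<comment> \<open>The supremum \<open>r\<close> is approached only up to \<open>1/k\<close>; the
      archimedean axiom removes the error.\<close>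
    have "of_nat k * (r *\<^sub>R ?p - d * ?p) \<le> ?p" if k: "k \<ge> 1" for k :: nat
    proof -
      have "r - 1 / k < Sup (\<rho> ` S)" using k by (simp add: r_def)
      then obtain y where y: "y \<in> S" "r - 1 / k < \<rho> y" using less_cSupE[of "r - 1 / k" "\<rho> ` S"] nS by blast
      have "(r - 1 / k) *\<^sub>R ?p \<le> \<rho> y *\<^sub>R ?p" using y by (intro scaleR_right_mono p0) simp
      also have "\<dots> \<le> d * ?p" unfolding \<rho>[OF y(1), symmetric]
        using y(1) by (intro mult_right_mono p0) (simp add: S_def)
      finally have "r *\<^sub>R ?p - d * ?p \<le> (1 / k) *\<^sub>R ?p"
        by (simp only: scaleR_diff_left diff_le_eq) (simp add: add.commute)
      from scaleR_left_mono[OF this, of "real k"] show ?thesis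
        using k by (simp add: scaleR_conv_of_real[of "real k" "_ - _"])
    qed
    then have "r *\<^sub>R ?p - d * ?p \<le> 0" by (rule bal_archimedean)
    then show ?thesis by simp
  qed
  ultimately show ?thesis using order_antisym by blast
qed

lemma mult_atom: "M \<in> Ysp \<Longrightarrow> d * x (atom M) = coord d M *\<^sub>R x (atom M)"
  using coord_exists[of M d] coord_eqI[of M d] by auto

lemma coord_add: "M \<in> Ysp \<Longrightarrow> coord (a + b) M = coord a M + coord b M"
  by (rule coord_eqI) (simp_all add: distrib_right mult_atom scaleR_add_left)

lemma coord_scaleR: "M \<in> Ysp \<Longrightarrow> coord (r *\<^sub>R a) M = r * coord a M"
  by (rule coord_eqI) (simp_all add: mult_atom)

lemma coord_mult: "M \<in> Ysp \<Longrightarrow> coord (a * b) M = coord a M * coord b M"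
  by (rule coord_eqI) (simp_all add: mult_atom mult.assoc mult.commute)

lemma coord_of_real: "M \<in> Ysp \<Longrightarrow> coord (of_real r) M = r"
  by (rule coord_eqI) (simp_all add: scaleR_conv_of_real)

lemma coord_x: "M \<in> Ysp \<Longrightarrow> coord (x b) M = val M b"
  by (rule coord_eqI) (simp_all add: x_mult_atom)

lemma coord_mono:
  assumes M: "M \<in> Ysp" and "a \<le> b" shows "coord a M \<le> coord b M"
  using mult_right_mono[OF assms(2) x_nonneg[of "atom M"]]
  by (intro scaleR_atom_le[OF M]) (simp add: mult_atom[OF M])

lemma coord_diff: "M \<in> Ysp \<Longrightarrow> coord (a - b) M = coord a M - coord b M"
  using coord_add[of M "a - b" b] by simp

text \<open>By join density at \<open>a\<close> and meet density at \<open>b\<close> it suffices to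
  compare elements of \<open>R[B]\<close> below \<open>a\<close> with those above \<open>b\<close>;
  their difference is a combination covered by \<open>combination_le_0\<close>.\<close>

lemma le_iff_coord: "a \<le> b \<longleftrightarrow> (\<forall>M\<in>Ysp. coord a M \<le> coord b M)"
proof
  assume le: "\<forall>M\<in>Ysp. coord a M \<le> coord b M"
  have dense: "is_lub {y \<in> range (peval x). y \<le> a} a" "is_glb {y \<in> range (peval x). b \<le> y} b"
    using x unfolding dedekind_completion_RB_def by blast+
  have "peval x p \<le> peval x q" if p: "peval x p \<le> a" and q: "b \<le> peval x q" for p q
  proof -
    obtain K c B where K: "finite K" and r: "peval x (p - q) = (\<Sum>k\<in>(K::('b \<Rightarrow>\<^sub>0 nat) set). c k *\<^sub>R x (B k))"
      using peval_x_representation by blast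
    have "x top * (of_real 0 + (\<Sum>k\<in>K. c k *\<^sub>R x (B k))) \<le> 0"
    proof (rule combination_le_0[OF K])
      fix M :: "'a set" assume M: "M \<in> Ysp"
      have "coord (peval x (p - q)) M = coord (peval x p) M - coord (peval x q) M"
        using M by (simp add: peval_diff coord_diff)
      also have "\<dots> \<le> 0" using coord_mono[OF M p] coord_mono[OF M q] le M by fastforce
      moreover have "coord (peval x (p - q)) M = (\<Sum>k\<in>K. c k * val M (B k))"
        unfolding r by (rule coord_eqI[OF M]) (simp add: sum_distrib_right x_mult_atom[OF M] scaleR_sum_left)
      ultimately show "0 + (\<Sum>k\<in>K. c k * val M (B k)) \<le> 0" by simp
    qed
    then have "peval x p - peval x q \<le> 0" using r by (simp add: x_top peval_diff)
    then show ?thesis by simp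
  qed
  then have "peval x p \<le> b" if "peval x p \<le> a" for p
    using dense(2) that unfolding is_glb_def by blast
  then show "a \<le> b" using dense(1) unfolding is_lub_def by blast
qed (use coord_mono in blast)

lemma coord_in_BY: "coord d \<in> BY"
proof -
  obtain n where n: "1 \<le> n" "d \<le> of_real n" "- of_real n \<le> d" using ex_real_bound by blast
  have "\<bar>coord d M\<bar> \<le> n" if M: "M \<in> Ysp" for M
    using coord_mono[OF M n(2)] coord_mono[OF M, of "of_real (- n)" d] n(3)
      coord_of_real[OF M, of n] coord_of_real[OF M, of "- n"] by auto
  then show ?thesis unfolding BY_def by (auto simp: bounded_iff coord_def)
qed

text \<open>With \<open>c\<close> a bound of \<open>f\<close>, the element sought is the join of the
  \<open>y N\<close>, where \<open>y N\<close> has coordinate \<open>f N\<close> at \<open>N\<close>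
  and the lower bound \<open>- c\<close> elsewhere.\<close>

lemma coord_surj:
  assumes f: "f \<in> BY" shows "\<exists>d. coord d = f"
proof -
  obtain c where c: "\<And>M. M \<in> Ysp \<Longrightarrow> \<bar>f M\<bar> \<le> c" using f unfolding BY_def bounded_iff by auto
  define y where "y N = of_real (- c) + (f N + c) *\<^sub>R x (atom N)" for N
  have cy: "coord (y N) M = (if M = N then f N else - c)" if "M \<in> Ysp" "N \<in> Ysp" for M N
  proof -
    have "val M (atom N) = (if M = N then 1 else 0)"
      using that Ysp_maximal[of N M] by (auto simp: atom_def val_compl val_e Ysp_Arch)
    then show ?thesis using that
      by (simp add: y_def coord_add coord_scaleR coord_of_real coord_x del: of_real_minus)
  qed
  define S where "S = y ` Ysp"
  have ub: "z \<le> of_real c" if "z \<in> S" for z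
    unfolding le_iff_coord
  proof
    fix M :: "'a set" assume M: "M \<in> Ysp"
    obtain N where N: "N \<in> Ysp" "z = y N" using \<open>z \<in> S\<close> unfolding S_def by blast
    show "coord z M \<le> coord (of_real c) M" unfolding N(2) cy[OF M N(1)] coord_of_real[OF M]
      using c[OF M] c[OF N(1)] by (auto simp: abs_le_iff)
  qed
  have "S \<noteq> {}" using Ysp_nonempty by (simp add: S_def)
  moreover have "dedekind_complete TYPE('d)" using x unfolding dedekind_completion_RB_def by simp
  ultimately obtain d where d: "is_lub S d"
    using ub unfolding dedekind_complete_def by metis
  have "coord d M = f M" if M: "M \<in> Ysp" for M
  proof (rule antisym)
    have "y M \<le> d" using d M unfolding is_lub_def S_def by blast
    then show "f M \<le> coord d M" using coord_mono[OF M, of "y M" d] cy[OF M M] by simp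
    \<comment> \<open>An upper bound of all \<open>y N\<close> that is exact at \<open>M\<close>, so
      the join cannot exceed \<open>f M\<close> there.\<close>
    define u where "u = of_real c + (f M - c) *\<^sub>R x (atom M)"
    have cu: "coord u N = (if N = M then f M else c)" if N: "N \<in> Ysp" for N
    proof -
      have "val N (atom M) = (if N = M then 1 else 0)"
        using N M Ysp_maximal[of M N] by (auto simp: atom_def val_compl val_e Ysp_Arch)
      then show ?thesis using N by (simp add: u_def coord_add coord_scaleR coord_of_real coord_x)
    qed
    have "y N \<le> u" if N: "N \<in> Ysp" for N
      unfolding le_iff_coord
    proof
      fix P :: "'a set" assume P: "P \<in> Ysp"
      show "coord (y N) P \<le> coord u P" unfolding cy[OF P N] cu[OF P]
        using c[OF P] c[OF N] by (auto simp: abs_le_iff)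
    qed
    then have "d \<le> u" using d unfolding is_lub_def S_def by blast
    then show "coord d M \<le> f M" using coord_mono[OF M, of d u] cu[OF M] by simp
  qed
  then have "coord d = f" using f by (auto simp: coord_def BY_def)
  then show ?thesis ..
qed

lemma coord_eq_iff: "coord a = coord b \<longleftrightarrow> a = b"
  using le_iff_coord[of a b] le_iff_coord[of b a] by (metis order_antisym order_refl)

text \<open>Surjectivity supplies an element whose coordinates are the maxima; since coordinates
  detect the order, it is the join.\<close>

lemma coord_sup:
  assumes M: "M \<in> Ysp" shows "coord (sup a b) M = max (coord a M) (coord b M)"
proof -
  have "psi (\<lambda>M. max (coord a M) (coord b M)) \<in> BY"
    using bounded_pointwise(3)[of "coord a" Ysp "coord b"] coord_in_BY[of a] coord_in_BY[of b]
    by (simp add: BY_def psi_def cong: image_cong_simp)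
  then obtain c where "coord c = psi (\<lambda>M. max (coord a M) (coord b M))" using coord_surj by blast
  then have c: "coord c N = max (coord a N) (coord b N)" if "N \<in> Ysp" for N using that by (simp add: psi_def)
  have "sup a b = c"
  proof (rule antisym)
    show "sup a b \<le> c" by (rule sup_least) (simp_all add: le_iff_coord c)
    show "c \<le> sup a b" unfolding le_iff_coord
      using coord_mono[OF _ sup_ge1[of a b]] coord_mono[OF _ sup_ge2[of b a]] by (simp add: c)
  qed
  then show ?thesis using c[OF M] by simp
qed

lemma coord_minus: "M \<in> Ysp \<Longrightarrow> coord (- a) M = - coord a M"
  using coord_scaleR[of M "- 1" a] by simp

lemma coord_inf: "M \<in> Ysp \<Longrightarrow> coord (inf a b) M = min (coord a M) (coord b M)"
  by (simp only: inf_eq_neg_sup[of a b] coord_minus coord_sup)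

section \<open>Isomorphisms of the completion with B(Y) and N(X)\<close>

lemma bij_betw_coord: "bij_betw coord UNIV BY"
proof (rule bij_betw_imageI)
  show "inj coord" using coord_eq_iff by (simp add: inj_def)
  show "range coord = BY" using coord_in_BY coord_surj by (auto simp: image_iff) metis
qed

lemma bounded_coord: "bounded (coord d ` Xsp)"
  by (rule BY_bounded[OF coord_in_BY])

lemma bounded_nrm_coord: "bounded (nrm (coord d) ` Xsp)"
  by (rule NX_bounded[OF nrm_in_NX[OF bounded_coord]])

lemma iso_DN_nrm_coord: "iso_DN (\<lambda>d. nrm (coord d))"
  unfolding iso_DN_def
proof (intro conjI allI)
  have "bij_betw nrm BY NX"
    by (rule bij_betw_byWitness[where f' = psi])
      (auto simp: nrm_psi psi_nrm BY_bounded psi_BY psi_in_BY nrm_in_NX)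
  from bij_betw_trans[OF bij_betw_coord this] show "bij_betw (\<lambda>d. nrm (coord d)) UNIV NX"
    by (simp add: comp_def)
  fix a b :: 'd and r :: real
  note bd = bounded_pointwise[OF bounded_nrm_coord[of a] bounded_nrm_coord[of b]]
    bounded_scale[OF bounded_nrm_coord[of a], of r]
  note nrm_cong = nrm_cong_Ysp[OF bounded_coord]
  show "nrm (coord (a + b)) = nrm (\<lambda>I. nrm (coord a) I + nrm (coord b) I)"
    by (rule nrm_cong[OF bd(1)]) (simp add: nrm_Ysp bounded_coord coord_add)
  show "nrm (coord (a * b)) = nrm (\<lambda>I. nrm (coord a) I * nrm (coord b) I)"
    by (rule nrm_cong[OF bd(2)]) (simp add: nrm_Ysp bounded_coord coord_mult)
  show "nrm (coord (sup a b)) = nrm (\<lambda>I. max (nrm (coord a) I) (nrm (coord b) I))"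
    by (rule nrm_cong[OF bd(3)]) (simp add: nrm_Ysp bounded_coord coord_sup)
  show "nrm (coord (inf a b)) = nrm (\<lambda>I. min (nrm (coord a) I) (nrm (coord b) I))"
    by (rule nrm_cong[OF bd(4)]) (simp add: nrm_Ysp bounded_coord coord_inf)
  show "nrm (coord (r *\<^sub>R a)) = nrm (\<lambda>I. r * nrm (coord a) I)"
    by (rule nrm_cong[OF bd(5)]) (simp add: nrm_Ysp bounded_coord coord_scaleR)
  show "nrm (coord 1) = nrm (chiX Xsp)"
    using Ysp_subset_Xsp coord_of_real[of _ 1]
    by (intro nrm_cong[OF bounded_chiX]) (auto simp: chiX_def)
qed

lemma coord_x_e: "M \<in> Ysp \<Longrightarrow> I \<in> Arch \<Longrightarrow> coord (x (e I)) M = (if I \<subseteq> M then 0 else 1)"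
  by (simp add: coord_x val_e)

text \<open>The infimum of a 0-1 function over \<open>Yup J\<close> is 1 exactly when no maximal
  l-ideal above \<open>J\<close> contains \<open>I\<close>, which is the condition for
  \<open>J\<close> to lie in \<open>Uset I\<close>.\<close>

lemma nrm_coord_x_e:
  assumes I: "I \<in> Arch" shows "nrm (coord (x (e I))) = chiX (Uset I)"
proof
  fix J
  show "nrm (coord (x (e I))) J = chiX (Uset I) J"
  proof (cases "J \<in> Xsp")
    case False
    then show ?thesis by (simp add: nrm_outside chiX_def)
  next
    case J: True
    let ?F = "(\<lambda>M. if I \<subseteq> M then 0 else 1 :: real) ` Yup J"
    have *: "nrm (coord (x (e I))) J = Inf ?F"
      unfolding nrm_eq[OF bounded_coord J]
      by (intro arg_cong[where f = Inf] image_cong refl) (simp add: coord_x_e I Yup_def)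
    show ?thesis
    proof (cases "arch_join J I = UNIV")
      case True
      then have "?F = (\<lambda>M. 1) ` Yup J"
        unfolding arch_join_eq_UNIV_iff by (intro image_cong) (auto simp: Yup_def)
      then have "?F = {1}" using Yup_nonempty[OF J] by auto
      then show ?thesis using * True J by (simp add: chiX_def Uset_def)
    next
      case False
      then obtain M where "M \<in> Yup J" "I \<subseteq> M" unfolding arch_join_eq_UNIV_iff Yup_def by auto
      then have "0 \<in> ?F" by force
      then have "Inf ?F = 0" by (rule cInf_eq_minimum) auto
      then show ?thesis using * False J by (simp add: chiX_def Uset_def)
    qed
  qed
qed

context
  fixes \<phi> :: "'d \<Rightarrow> 'a set \<Rightarrow> real"
  assumes iso: "iso_DN \<phi>" and \<phi>_x: "\<And>I. I \<in> Arch \<Longrightarrow> \<phi> (x (e I)) = chiX (Uset I)"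
begin

lemma iso_in_NX: "\<phi> d \<in> NX"
  using iso unfolding iso_DN_def bij_betw_def by blast

text \<open>Evaluating \<open>\<phi>\<close> at \<open>M\<close> is multiplicative and linear, as
  normalization keeps values there, and it sends the idempotent of the atom to 1. Applying it to
  \<open>mult_atom\<close> leaves the coordinate, so \<open>\<phi>\<close> is uniquely
  determined.\<close>

lemma iso_Ysp:
  assumes M: "M \<in> Ysp" shows "\<phi> d M = coord d M"
proof -
  note bd = NX_bounded[OF iso_in_NX]
  note at_M = nrm_Ysp[OF _ M]
  have add: "\<phi> (a + b) M = \<phi> a M + \<phi> b M" for a b
    using iso at_M[OF bounded_pointwise(1)[OF bd bd]] unfolding iso_DN_def by simp
  have mult: "\<phi> (a * b) M = \<phi> a M * \<phi> b M" for a b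
    using iso at_M[OF bounded_pointwise(2)[OF bd bd]] unfolding iso_DN_def by simp
  have scale: "\<phi> (r *\<^sub>R a) M = r * \<phi> a M" for r a
    using iso at_M[OF bounded_scale[OF bd]] unfolding iso_DN_def by simp
  have "\<phi> 1 M = chiX Xsp M" using iso at_M[OF bounded_chiX] unfolding iso_DN_def by simp
  then have one: "\<phi> 1 M = 1" using M Ysp_subset_Xsp by (auto simp: chiX_def)
  have "\<phi> (x (e M)) M = 0"
    using arch_join_Ysp[OF M, of M] by (simp add: \<phi>_x Ysp_Arch M chiX_def Uset_def)
  moreover have "x (atom M) + x (e M) = 1" by (simp add: atom_def x_compl)
  ultimately have "\<phi> (x (atom M)) M = 1" using add[of "x (atom M)" "x (e M)"] one by simp
  then show ?thesis
    using mult[of d "x (atom M)"] scale[of "coord d M" "x (atom M)"] by (simp add: mult_atom[OF M])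
qed

lemma psi_iso: "psi (\<phi> d) = coord d"
  by (auto simp: psi_def iso_Ysp coord_def)

lemma iso_Xsp: "I \<in> Xsp \<Longrightarrow> \<phi> d I = Inf (coord d ` Yup I)"
  using nrm_eq[OF bounded_coord, of I d] nrm_psi[OF iso_in_NX, of d] by (simp add: psi_iso)

end

text \<open>The join in \<open>alpha\<close> is the element whose coordinates are the residues of
  \<open>a + s\<close>. A generator for \<open>r\<close> and \<open>I\<close> has coordinate
  \<open>r\<close>, at most the residue, where \<open>I\<close> lies in \<open>N\<close>, and 0
  elsewhere, where the choice of \<open>s\<close> makes the residue nonnegative. Taking
  \<open>I = N\<close> and the residue as \<open>r\<close> attains the value at
  \<open>N\<close>.\<close>

lemma coord_alpha:
  assumes M: "M \<in> Ysp" shows "coord (alpha e x a) M = zeta a M"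
proof -
  define s where "s = (SOME s::real. 0 \<le> a + of_real s)"
  obtain n where "- of_real n \<le> a" using ex_real_bound[of a] by blast
  then have "0 \<le> a + of_real n" using add_right_mono[of "- of_real n" a "of_real n"] by simp
  then have s: "0 \<le> a + of_real s" unfolding s_def by (rule someI)
  define S where "S = {r *\<^sub>R x (- e I) | r I. I \<in> Arch \<and> negpart (a + of_real s - of_real r) \<in> I}"
  obtain d where d: "coord d = zeta (a + of_real s)" using coord_surj[OF zeta_in_BY] by blast
  have d0: "0 \<le> zeta (a + of_real s) N" if "N \<in> Ysp" for N
    using zeta_mono[OF that s] zeta_of_real[OF that, of 0] by simp
  have cS: "coord (r *\<^sub>R x (- e I)) N = (if I \<subseteq> N then r else 0)" if "N \<in> Ysp" "I \<in> Arch" for r I N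
    using that by (simp add: coord_scaleR coord_x val_compl val_e)
  have "is_lub S d" unfolding is_lub_def
  proof (intro conjI ballI allI impI)
    fix y assume "y \<in> S"
    then obtain r I where y: "y = r *\<^sub>R x (- e I)" "I \<in> Arch" "negpart (a + of_real s - of_real r) \<in> I"
      unfolding S_def by blast
    show "y \<le> d" unfolding le_iff_coord d y(1)
    proof
      fix N :: "'a set" assume N: "N \<in> Ysp"
      show "coord (r *\<^sub>R x (- e I)) N \<le> zeta (a + of_real s) N"
        unfolding cS[OF N y(2)] using d0[OF N] y(3) negpart_mem_iff[OF N, of "a + of_real s" r] by auto
    qed
  next
    fix u assume u: "\<forall>y\<in>S. y \<le> u"
    show "d \<le> u" unfolding le_iff_coord d
    proof
      fix N :: "'a set" assume N: "N \<in> Ysp"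
      let ?r = "zeta (a + of_real s) N"
      have "negpart (a + of_real s - of_real ?r) \<in> N" using negpart_mem_iff[OF N] by simp
      then have "?r *\<^sub>R x (- e N) \<in> S" unfolding S_def using Ysp_Arch[OF N] by blast
      then have "?r *\<^sub>R x (- e N) \<le> u" using u by blast
      from coord_mono[OF N this] show "?r \<le> coord u N" by (simp add: cS[OF N Ysp_Arch[OF N]])
    qed
  qed
  moreover from this have "t = d" if "is_lub S t" for t
    using that unfolding is_lub_def by (blast intro: order_antisym)
  ultimately have "dlub S = d" unfolding dlub_def by (rule the_equality)
  then have "alpha e x a = - of_real s + d" unfolding alpha_def Let_def s_def[symmetric] S_def by simp
  then have "coord (alpha e x a) M = - s + coord d M"
    by (simp add: coord_diff[OF M] coord_of_real[OF M])
  then show ?thesis unfolding d by (simp add: zeta_add_of_real[OF M])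
qed

end

text \<open>Since \<open>I\<close> is the intersection of the maximal l-ideals above it, the reals
  on the right form the closed half-line ending at the infimum of the residues.\<close>

lemma Inf_zeta_eq:
  assumes I: "I \<in> Xsp"
  shows "Inf (zeta a ` Yup I) = Sup {r. negpart (a - of_real r) \<in> I}"
proof -
  have IA: "I \<in> Arch" using I by (simp add: Xsp_def)
  have ne: "zeta a ` Yup I \<noteq> {}" using Yup_nonempty[OF I] by simp
  have "bounded (zeta a ` Ysp)" using zeta_in_BY[of a] by (simp add: BY_def)
  then have bdd: "bdd_below (zeta a ` Yup I)"
    by (rule bdd_below_mono[OF bounded_imp_bdd_below]) (auto simp: Yup_def)
  have "negpart (a - of_real r) \<in> I \<longleftrightarrow> r \<le> Inf (zeta a ` Yup I)" for r
    unfolding Arch_mem_iff[OF IA] le_cInf_iff[OF ne bdd]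
    by (auto simp: Yup_def negpart_mem_iff)
  then have "{r. negpart (a - of_real r) \<in> I} = {..Inf (zeta a ` Yup I)}" by auto
  then show ?thesis by simp
qed

theorem mainTheorem14:
  fixes e :: "'a::bal_algebra set \<Rightarrow> 'b::boolean_algebra"
    and x :: "'b \<Rightarrow> 'd::bal_algebra"
  assumes "free_bool_ext e"
    and "dedekind_completion_RB x"
  shows "(\<exists>\<phi>::'d \<Rightarrow> 'a set \<Rightarrow> real. iso_DN \<phi> \<and> (\<forall>I\<in>Arch. \<phi> (x (e I)) = chiX (Uset I)))
    \<and> iso_NY (psi :: ('a set \<Rightarrow> real) \<Rightarrow> _)
    \<and> (\<forall>\<phi>::'d \<Rightarrow> 'a set \<Rightarrow> real. iso_DN \<phi> \<and> (\<forall>I\<in>Arch. \<phi> (x (e I)) = chiX (Uset I)) \<longrightarrow>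
         (\<forall>I\<in>Arch. psi (\<phi> (x (e I))) = chiY {M \<in> Ysp. \<not> I \<subseteq> M})
       \<and> (\<forall>a. psi (\<phi> (alpha e x a)) = zeta a)
       \<and> (\<forall>a. \<forall>I\<in>Xsp. \<phi> (alpha e x a) I = Sup {r. negpart (a - of_real r) \<in> I}))"
proof -
  interpret bal_completion e x using assms by unfold_locales
  \<comment> \<open>Outside \<open>Ysp\<close> both functions take the default value 0.\<close>
  have coord_alpha': "coord (alpha e x a) = zeta a" for a
    using coord_alpha[of _ a] by (auto simp: coord_def zeta_def)
  show ?thesis
  proof (intro conjI allI impI ballI)
    show "\<exists>\<phi>::'d \<Rightarrow> 'a set \<Rightarrow> real. iso_DN \<phi> \<and> (\<forall>I\<in>Arch. \<phi> (x (e I)) = chiX (Uset I))"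
      using iso_DN_nrm_coord nrm_coord_x_e by (intro exI[of _ "\<lambda>d. nrm (coord d)"]) simp
    show "iso_NY (psi :: ('a set \<Rightarrow> real) \<Rightarrow> _)" by (rule iso_NY_psi)
    fix \<phi> :: "'d \<Rightarrow> 'a set \<Rightarrow> real"
    assume \<phi>: "iso_DN \<phi> \<and> (\<forall>I\<in>Arch. \<phi> (x (e I)) = chiX (Uset I))"
    then have psi: "psi (\<phi> d) = coord d" and inf: "J \<in> Xsp \<Longrightarrow> \<phi> d J = Inf (coord d ` Yup J)" for d J
      using psi_iso[of \<phi>] iso_Xsp[of \<phi>] by auto
    show "psi (\<phi> (x (e I))) = chiY {M \<in> Ysp. \<not> I \<subseteq> M}" if "I \<in> Arch" for I
    proof
      fix M
      show "psi (\<phi> (x (e I))) M = chiY {M \<in> Ysp. \<not> I \<subseteq> M} M"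
        unfolding psi using coord_x_e[OF _ that, of M] by (auto simp: chiY_def coord_def)
    qed
    fix a :: 'a
    show "psi (\<phi> (alpha e x a)) = zeta a" by (simp add: psi coord_alpha')
    show "\<phi> (alpha e x a) I = Sup {r. negpart (a - of_real r) \<in> I}" if "I \<in> Xsp" for I
      using inf[OF that] Inf_zeta_eq[OF that] by (simp add: coord_alpha')
  qed
qed

end
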